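(* Let $a,b\in\mathbb{R}$ with $a<b$ and $I:=(a,b)$. Let $\bar p_1,\bar p_2\in L^\infty(I)\setminus\{0\}$ be real-valued with $\bar p_1\ge 0$ and $\bar p_2\ge 0$ a.e. on $I$, and let $\hat A_1:=\hat A_{\bar p_1}$, $\hat A_2:=\hat A_{\bar p_2}$ be the corresponding operators. Then, in operator norm on $(L^2_{\mathbb{C}}(I))^2$, $$\|\hat A_1^{-1}-\hat A_2^{-1}\|\le\frac{2(b-a)}{\|\bar p_1\|_1}\left(2+\|\bar p_1\|_1+\|\bar p_2\|_1+\frac{1}{\|\bar p_2\|_1}\right)\|\bar p_2-\bar p_1\|_1 .$$
   Context: $L^2_{\mathbb{C}}(I)$ is the Hilbert space of complex-valued square-integrable functions on $I$; $(L^2_{\mathbb{C}}(I))^2$ carries the product Hilbert norm; $\|\cdot\|_1$ is the $L^1(I)$-norm. $D_I:C_0^\infty(I,\mathbb{C})\to L^2_{\mathbb{C}}(I)$, $D_If=f'$, is a densely-defined operator in $L^2_{\mathbb{C}}(I)$, with Hilbert space adjoint $D_I^*$; its domain is the Sobolev space $D(D_I^* )=W^1_{\mathbb{C}}(I)$, and $-D_I^*$ is the weak derivative. $W^1_{0,\mathbb{C}}(I)$ is the closure of $C_0^\infty(I,\mathbb{C})$ in $W^1_{\mathbb{C}}(I)$ with respect to the norm $(\|f\|_2^2+\|D_I^*f\|_2^2)^{1/2}$. For real-valued $\bar p\in L^\infty(I)$, $\hat A_{\bar p}:W^1_{0,\mathbb{C}}(I)\times D(D_I^* )\to(L^2_{\mathbb{C}}(I))^2$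 is the densely-defined operator in $(L^2_{\mathbb{C}}(I))^2$ given by $\hat A_{\bar p}(u,q)=(D_I^*q,\ -D_I^*u-\bar p\,q)$. For $\bar p\in L^\infty(I)\setminus\{0\}$ with $\bar p\ge0$ a.e. it is self-adjoint and bijective with bounded inverse. *)

theory Defs
  imports "HOL-Analysis.Analysis"
begin

definition sq_integrable :: "real measure \<Rightarrow> (real \<Rightarrow> complex) set" where
  "sq_integrable M =
     {f \<in> borel_measurable M. integrable M (\<lambda>x. (cmod (f x))\<^sup>2)}"

definition ae_eq :: "real measure \<Rightarrow> ((real \<Rightarrow> complex) \<times> (real \<Rightarrow> complex)) set" where
  "ae_eq M = {(f, g). f \<in> sq_integrable M \<and> g \<in> sq_integrable M \<and> (AE x in M. f x = g x)}"

lemma equiv_ae_eq: "equiv (sq_integrable M) (ae_eq M)"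
proof (rule equivI)
  show "trans (ae_eq M)"
    unfolding ae_eq_def trans_def by (auto elim: eventually_elim2)
  show "sym (ae_eq M)"
    unfolding ae_eq_def sym_def by (auto elim: eventually_mono)
qed (auto simp: ae_eq_def refl_on_def)

text \<open>Elements of \<open>L2 M\<close> are equivalence classes; operations on them are defined through
  an arbitrary representative.\<close>

type_synonym fclass = "(real \<Rightarrow> complex) set"

definition L2 :: "real measure \<Rightarrow> fclass set" where
  "L2 M = sq_integrable M // ae_eq M"

definition cls :: "real measure \<Rightarrow> (real \<Rightarrow> complex) \<Rightarrow> fclass" where
  "cls M f = ae_eq M `` {f}"

definition rep :: "fclass \<Rightarrow> real \<Rightarrow> complex" where
  "rep X = (SOME f. f \<in> X)"

definition l2_diff :: "real measure \<Rightarrow> fclass \<Rightarrow> fclass \<Rightarrow> fclass" where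
  "l2_diff M X Y = cls M (\<lambda>x. rep X x - rep Y x)"

definition l2_inner :: "real measure \<Rightarrow> fclass \<Rightarrow> fclass \<Rightarrow> complex" where
  "l2_inner M X Y = (LINT x|M. cnj (rep X x) * rep Y x)"

definition l2_norm :: "real measure \<Rightarrow> fclass \<Rightarrow> real" where
  "l2_norm M X = sqrt (LINT x|M. (cmod (rep X x))\<^sup>2)"

lemma cls_in_L2: "f \<in> sq_integrable M \<Longrightarrow> cls M f \<in> L2 M"
  unfolding L2_def cls_def by (rule quotientI)

lemma rep_cls:
  assumes "f \<in> sq_integrable M"
  shows "rep (cls M f) \<in> sq_integrable M" and "AE x in M. rep (cls M f) x = f x"
proof -
  have "f \<in> cls M f"
    using assms by (simp add: cls_def ae_eq_def)
  then have "rep (cls M f) \<in> cls M f"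
    unfolding rep_def by (rule someI[where P = "\<lambda>h. h \<in> cls M f"])
  then show "rep (cls M f) \<in> sq_integrable M" and "AE x in M. rep (cls M f) x = f x"
    by (auto simp: cls_def ae_eq_def elim: eventually_mono)
qed

lemma l2_inner_cls:
  assumes f: "f \<in> sq_integrable M" and g: "g \<in> sq_integrable M"
  shows "l2_inner M (cls M f) (cls M g) = (LINT x|M. cnj (f x) * g x)"
  unfolding l2_inner_def
proof (rule integral_cong_AE)
  have meas: "f \<in> borel_measurable M" "g \<in> borel_measurable M"
    "rep (cls M f) \<in> borel_measurable M" "rep (cls M g) \<in> borel_measurable M"
    using f g rep_cls(1)[OF f] rep_cls(1)[OF g] by (auto simp: sq_integrable_def)
  show "(\<lambda>x. cnj (rep (cls M f) x) * rep (cls M g) x) \<in> borel_measurable M"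
    "(\<lambda>x. cnj (f x) * g x) \<in> borel_measurable M"
    by (intro borel_measurable_times
          borel_measurable_continuous_on[OF continuous_on_cnj[OF continuous_on_id]] meas)+
  show "AE x in M. cnj (rep (cls M f) x) * rep (cls M g) x = cnj (f x) * g x"
    using rep_cls(2)[OF f] rep_cls(2)[OF g] by eventually_elim simp
qed

lemma l2_norm_cls:
  assumes f: "f \<in> sq_integrable M"
  shows "l2_norm M (cls M f) = sqrt (LINT x|M. (cmod (f x))\<^sup>2)"
proof -
  have [measurable]: "f \<in> borel_measurable M" "rep (cls M f) \<in> borel_measurable M"
    using f rep_cls(1)[OF f] by (auto simp: sq_integrable_def)
  have "(LINT x|M. (cmod (rep (cls M f) x))\<^sup>2) = (LINT x|M. (cmod (f x))\<^sup>2)"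
    using rep_cls(2)[OF f] by (intro integral_cong_AE) (auto elim: eventually_mono)
  then show ?thesis
    by (simp add: l2_norm_def)
qed

definition pair_diff ::
    "real measure \<Rightarrow> fclass \<times> fclass \<Rightarrow> fclass \<times> fclass \<Rightarrow> fclass \<times> fclass" where
  "pair_diff M v w = (l2_diff M (fst v) (fst w), l2_diff M (snd v) (snd w))"

definition pair_norm :: "real measure \<Rightarrow> fclass \<times> fclass \<Rightarrow> real" where
  "pair_norm M v = sqrt ((l2_norm M (fst v))\<^sup>2 + (l2_norm M (snd v))\<^sup>2)"

text \<open>The operator norm is extended-real valued, so that it is \<open>\<infinity>\<close> for an unbounded map; as for
  \<^const>\<open>onorm\<close>, the zero vector contributes \<open>0 / 0 = 0\<close>.\<close>

definition pair_opnorm :: "real measure \<Rightarrow> (fclass \<times> fclass \<Rightarrow> fclass \<times> fclass) \<Rightarrow> ereal" where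
  "pair_opnorm M T = (SUP v \<in> L2 M \<times> L2 M. ereal (pair_norm M (T v) / pair_norm M v))"

text \<open>An operator is given by its domain \<open>S\<close> and a map \<open>T\<close> whose values off \<open>S\<close> are irrelevant.\<close>

definition adj_dom :: "real measure \<Rightarrow> fclass set \<Rightarrow> (fclass \<Rightarrow> fclass) \<Rightarrow> fclass set" where
  "adj_dom M S T =
     {Y \<in> L2 M. \<exists>Z \<in> L2 M. \<forall>X \<in> S. l2_inner M (T X) Y = l2_inner M X Z}"

definition adj :: "real measure \<Rightarrow> fclass set \<Rightarrow> (fclass \<Rightarrow> fclass) \<Rightarrow> fclass \<Rightarrow> fclass" where
  "adj M S T Y = (THE Z. Z \<in> L2 M \<and> (\<forall>X \<in> S. l2_inner M (T X) Y = l2_inner M X Z))"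

text \<open>Test functions on \<open>I\<close> are identified with their extensions by zero to the real line.\<close>

definition test_funs :: "real set \<Rightarrow> (real \<Rightarrow> complex) set" where
  "test_funs I =
     {f. (\<forall>n x. ((\<lambda>g t. vector_derivative g (at t)) ^^ n) f differentiable (at x)) \<and>
         compact (closure {x. f x \<noteq> 0}) \<and> closure {x. f x \<noteq> 0} \<subseteq> I}"

definition D_dom :: "real set \<Rightarrow> fclass set" where
  "D_dom I = cls (lebesgue_on I) ` test_funs I"

definition D_op :: "real set \<Rightarrow> fclass \<Rightarrow> fclass" where
  "D_op I X = cls (lebesgue_on I)
     (\<lambda>x. vector_derivative (SOME f. f \<in> test_funs I \<and> cls (lebesgue_on I) f = X) (at x))"

definition W1 :: "real set \<Rightarrow> fclass set" where
  "W1 I = adj_dom (lebesgue_on I) (D_dom I) (D_op I)"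

definition D_adj :: "real set \<Rightarrow> fclass \<Rightarrow> fclass" where
  "D_adj I = adj (lebesgue_on I) (D_dom I) (D_op I)"

definition W1_norm :: "real set \<Rightarrow> fclass \<Rightarrow> real" where
  "W1_norm I X =
     sqrt ((l2_norm (lebesgue_on I) X)\<^sup>2 + (l2_norm (lebesgue_on I) (D_adj I X))\<^sup>2)"

definition W10 :: "real set \<Rightarrow> fclass set" where
  "W10 I =
     {X \<in> W1 I. \<forall>e>0. \<exists>Y \<in> D_dom I. W1_norm I (l2_diff (lebesgue_on I) X Y) < e}"

definition A_dom :: "real set \<Rightarrow> (fclass \<times> fclass) set" where
  "A_dom I = W10 I \<times> W1 I"

definition A_op :: "real set \<Rightarrow> (real \<Rightarrow> real) \<Rightarrow> fclass \<times> fclass \<Rightarrow> fclass \<times> fclass" where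
  "A_op I p = (\<lambda>(u, q).
     (D_adj I q,
      cls (lebesgue_on I) (\<lambda>x. - rep (D_adj I u) x - complex_of_real (p x) * rep q x)))"

definition A_inv :: "real set \<Rightarrow> (real \<Rightarrow> real) \<Rightarrow> fclass \<times> fclass \<Rightarrow> fclass \<times> fclass" where
  "A_inv I p = the_inv_into (A_dom I) (A_op I p)"

definition Linf :: "real measure \<Rightarrow> (real \<Rightarrow> real) set" where
  "Linf M = {p \<in> borel_measurable M. \<exists>C. AE x in M. \<bar>p x\<bar> \<le> C}"

definition l1_norm :: "real measure \<Rightarrow> (real \<Rightarrow> real) \<Rightarrow> real" where
  "l1_norm M p = (LINT x|M. \<bar>p x\<bar>)"

end

theory Submission
  imports Defs "HOL-Computational_Algebra.Polynomial"
begin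

text \<open>
  Why the estimate holds. The equation \<open>A(u, q) = (f, g)\<close> says \<open>-q' = f\<close> and \<open>u' - p q = g\<close>, with \<open>u\<close>
  vanishing at both end points. With \<open>F(x)\<close> the integral of \<open>f\<close> over \<open>(a, x)\<close> this forces \<open>q = c - F\<close>
  for a constant \<open>c\<close>, and \<open>u\<close> is the primitive of \<open>g + p q\<close>. The end point condition \<open>u(b) = 0\<close>
  is \<open>\<integral> (g + p q) = 0\<close>, which determines \<open>c\<close> because \<open>P = \<parallel>p\<parallel>\<^sub>1\<close> is positive; it also gives
  \<open>|q| \<le> \<parallel>f\<parallel>\<^sub>1 + \<parallel>g\<parallel>\<^sub>1 / P\<close> (\<open>cmod_flux_le\<close>).

  For two coefficients and the same \<open>(f, g)\<close> the difference \<open>d = q\<^sub>1 - q\<^sub>2\<close> is a constant, and both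
  \<open>\<integral> p\<^sub>i q\<^sub>i\<close> equal \<open>- \<integral> g\<close>. Subtracting yields \<open>P\<^sub>1 d = \<integral> (p\<^sub>2 - p\<^sub>1) q\<^sub>2\<close> and
  \<open>P\<^sub>2 d = \<integral> (p\<^sub>2 - p\<^sub>1) q\<^sub>1\<close> (\<open>flux_difference\<close>). The first identity bounds \<open>q\<^sub>1 - q\<^sub>2\<close>. For
  \<open>u\<^sub>1 - u\<^sub>2\<close>, the primitive of \<open>(p\<^sub>1 - p\<^sub>2) q\<^sub>1 + p\<^sub>2 d\<close>, the second one gives the sup bound
  \<open>2 \<parallel>p\<^sub>2 - p\<^sub>1\<parallel>\<^sub>1 sup |q\<^sub>1|\<close>. Pairing \<open>p\<^sub>2\<close> with \<open>q\<^sub>1\<close> here is what avoids a term \<open>P\<^sub>1 / P\<^sub>2\<close>, which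
  the claimed constant could not absorb. Passing between sup, \<open>L\<^sup>1\<close> and \<open>L\<^sup>2\<close> norms costs a factor
  \<open>\<surd>(b - a)\<close> twice (\<open>A_inv_difference_bound\<close>).

  It remains to see that the formulas above describe the inverse of the operator built from abstract
  adjoints. Everything rests on the density of test functions in \<open>L\<^sup>2\<close> (\<open>test_funs_dense_L2\<close>).
  Density makes the adjoint of differentiation single valued, so that an integration by parts
  (\<open>integral_by_parts_primitive\<close>, a use of Fubini's theorem) evaluates it on primitives. Density within
  the functions of mean zero shows that a primitive of a mean zero function is a limit of test
  functions in the Sobolev norm (\<open>primitive_zero_mean_in_W10\<close>); hence \<open>(u, q)\<close> lies in the domain and
  the operator is onto. Injectivity is a formal consequence: the operator is symmetric
  (\<open>A_op_symmetric\<close>), so an element of its kernel is orthogonal to the range, which is everything.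
\<close>

section \<open>Smooth functions and flat exponentials\<close>

text \<open>Coinduction turns a smoothness proof into the search for a class of functions closed under differentiation, which spares formulas for the iterated derivatives.\<close>

coinductive smooth :: "(real \<Rightarrow> 'a::real_normed_algebra) \<Rightarrow> bool" where
  smoothI: "(\<And>x. (f has_vector_derivative f' x) (at x)) \<Longrightarrow> smooth f' \<Longrightarrow> smooth f"

lemma smooth_vector_derivative:
  assumes "smooth f"
  shows "(f has_vector_derivative vector_derivative f (at x)) (at x)"
    and "smooth (\<lambda>x. vector_derivative f (at x))"
proof -
  obtain f' where f': "\<And>x. (f has_vector_derivative f' x) (at x)" "smooth f'"
    using assms by (cases rule: smooth.cases) blast
  then have "(\<lambda>y. vector_derivative f (at y)) = f'"
    by (simp add: vector_derivative_at fun_eq_iff)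
  with f' show "(f has_vector_derivative vector_derivative f (at x)) (at x)"
    and "smooth (\<lambda>x. vector_derivative f (at x))"
    by (simp_all add: fun_eq_iff)
qed

lemma smoothE:
  assumes "smooth f"
  obtains f' where "\<And>x. (f has_vector_derivative f' x) (at x)" "smooth f'"
  using smooth_vector_derivative[OF assms] by (rule that)

lemma smooth_iff_iterated_derivatives:
  "smooth f \<longleftrightarrow> (\<forall>n x. ((\<lambda>g t. vector_derivative g (at t)) ^^ n) f differentiable (at x))"
proof
  assume "smooth f"
  then have "smooth (((\<lambda>g t. vector_derivative g (at t)) ^^ n) f)" for n
    by (induction n) (auto intro: smooth_vector_derivative)
  then show "\<forall>n x. ((\<lambda>g t. vector_derivative g (at t)) ^^ n) f differentiable (at x)"
    by (blast intro: smooth_vector_derivative differentiableI_vector)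
next
  assume "\<forall>n x. ((\<lambda>g t. vector_derivative g (at t)) ^^ n) f differentiable (at x)"
  then show "smooth f"
  proof (coinduction arbitrary: f)
    case smooth
    then have "f differentiable (at x)" for x
      by (metis funpow_0)
    moreover have
      "((\<lambda>g t. vector_derivative g (at t)) ^^ n) (\<lambda>t. vector_derivative f (at t)) differentiable (at x)"
      for n x
      using smooth[rule_format, of "Suc n" x] by (simp only: funpow_Suc_right o_def)
    ultimately show ?case
      by (intro exI[of _ f] exI[of _ "\<lambda>t. vector_derivative f (at t)"])
        (auto simp: vector_derivative_works)
  qed
qed

text \<open>The product rule leads from a product to a sum of products, and the class of all sums of products is closed under differentiation.\<close>

inductive poly_in_smooth :: "(real \<Rightarrow> 'a::real_normed_algebra) \<Rightarrow> bool" where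
  times: "smooth f \<Longrightarrow> smooth g \<Longrightarrow> poly_in_smooth (\<lambda>x. f x * g x)"
| plus: "poly_in_smooth f \<Longrightarrow> poly_in_smooth g \<Longrightarrow> poly_in_smooth (\<lambda>x. f x + g x)"

lemma smooth_if_poly_in_smooth:
  assumes "poly_in_smooth f"
  shows "smooth f"
  using assms
proof (coinduction arbitrary: f)
  case smooth
  then have "\<exists>f'. (\<forall>x. (f has_vector_derivative f' x) (at x)) \<and> poly_in_smooth f'"
  proof induction
    case (times f g)
    obtain f' g' where *: "\<And>x. (f has_vector_derivative f' x) (at x)" "smooth f'"
        "\<And>x. (g has_vector_derivative g' x) (at x)" "smooth g'"
      using times smoothE by metis
    show ?case
      by (rule exI[of _ "\<lambda>x. f x * g' x + f' x * g x"])
        (use * times in \<open>auto intro!: has_vector_derivative_mult poly_in_smooth.intros\<close>)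
  next
    case (plus f g)
    then obtain f' g' where *: "\<And>x. (f has_vector_derivative f' x) (at x)" "poly_in_smooth f'"
        "\<And>x. (g has_vector_derivative g' x) (at x)" "poly_in_smooth g'"
      by blast
    show ?case
      by (rule exI[of _ "\<lambda>x. f' x + g' x"])
        (use * in \<open>auto intro!: has_vector_derivative_add poly_in_smooth.plus\<close>)
  qed
  then show ?case
    by blast
qed

lemma smooth_mult: "smooth f \<Longrightarrow> smooth g \<Longrightarrow> smooth (\<lambda>x. f x * g x)"
  by (rule smooth_if_poly_in_smooth[OF poly_in_smooth.times])

lemma smooth_const: "smooth (\<lambda>x. c)"
proof (coinduction arbitrary: c)
  case smooth
  show ?case
    by (rule exI[of _ "\<lambda>x. c"], rule exI[of _ "\<lambda>x. 0"]) auto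
qed

lemma smooth_add:
  assumes "smooth f" "smooth g" shows "smooth (\<lambda>x. f x + g x)"
  using assms
proof (coinduction arbitrary: f g)
  case smooth
  then obtain f' g' where *: "\<And>x. (f has_vector_derivative f' x) (at x)" "smooth f'"
        "\<And>x. (g has_vector_derivative g' x) (at x)" "smooth g'"
    using smoothE by metis
  show ?case
    by (rule exI[of _ "\<lambda>x. f x + g x"], rule exI[of _ "\<lambda>x. f' x + g' x"])
      (use * in \<open>auto intro!: has_vector_derivative_add\<close>)
qed

text \<open>Differentiation produces the factor \<open>k\<close>, so the coinduction runs over all multiples of the composed functions.\<close>

lemma smooth_affine:
  assumes "smooth f" shows "smooth (\<lambda>x. f (k * x + d))"
proof -
  have "smooth (\<lambda>x. c *\<^sub>R f (k * x + d))" for c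
    using assms
  proof (coinduction arbitrary: f c)
    case smooth
    then obtain f' where *: "\<And>x. (f has_vector_derivative f' x) (at x)" "smooth f'"
      using smoothE by metis
    have "((\<lambda>x. c *\<^sub>R f (k * x + d)) has_vector_derivative (c * k) *\<^sub>R f' (k * x + d)) (at x)" for x
    proof -
      have "((f \<circ> (\<lambda>x. k * x + d)) has_vector_derivative k *\<^sub>R f' (k * x + d)) (at x)"
        by (rule vector_diff_chain_at) (auto intro!: derivative_eq_intros *)
      from has_vector_derivative_scaleR[OF DERIV_const this, of c]
      show ?thesis by (simp add: o_def)
    qed
    then show ?case
      using * by (intro exI[of _ "\<lambda>x. c *\<^sub>R f (k * x + d)"] exI[of _ "\<lambda>x. (c * k) *\<^sub>R f' (k * x + d)"]) auto
  qed
  from this[of 1] show ?thesis by simp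
qed

text \<open>The classical function \<open>exp (-1/x)\<close>, extended by zero to \<open>x \<le> 0\<close>, times a polynomial in \<open>1/x\<close>. The polynomial factors make the class closed under differentiation.\<close>

definition flat_exp :: "real poly \<Rightarrow> real \<Rightarrow> real" where
  "flat_exp p x = (if x > 0 then poly p (1 / x) * exp (- (1 / x)) else 0)"

text \<open>This decay is what makes the flat exponentials differentiable at the origin, with derivative zero.\<close>

lemma tendsto_poly_exp_neg: "((\<lambda>y::real. poly p y * exp (- y)) \<longlongrightarrow> 0) at_top"
proof -
  have "((\<lambda>y. \<Sum>i\<le>degree p. coeff p i * (y ^ i / exp y)) \<longlongrightarrow> (\<Sum>i\<le>degree p. coeff p i * 0)) at_top"
    by (intro tendsto_intros tendsto_power_div_exp_0)
  moreover have "(\<Sum>i\<le>degree p. coeff p i * (y ^ i / exp y)) = poly p y * exp (- y)" for y :: real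
    by (simp add: poly_altdef sum_divide_distrib exp_minus divide_inverse sum_distrib_right mult.assoc)
  ultimately show ?thesis by simp
qed

lemma has_field_derivative_flat_exp:
  "(flat_exp p has_real_derivative flat_exp ([:0, 0, 1:] * (p - pderiv p)) x) (at x)"
proof (cases x "0::real" rule: linorder_cases)
  case less
  have "((\<lambda>_. 0) has_real_derivative 0) (at x)" by simp
  then have "(flat_exp p has_real_derivative 0) (at x)"
    by (rule has_field_derivative_transform_within_open[where S="{..<0}"])
      (use less in \<open>auto simp: flat_exp_def\<close>)
  then show ?thesis using less by (simp add: flat_exp_def)
next
  case greater
  have "((\<lambda>x. poly p (1 / x) * exp (- (1 / x))) has_real_derivative
      flat_exp ([:0, 0, 1:] * (p - pderiv p)) x) (at x)"
    using greater
    by (auto intro!: derivative_eq_intros DERIV_chain2[OF poly_DERIV]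
        simp: flat_exp_def field_simps power2_eq_square)
  then show ?thesis
    by (rule has_field_derivative_transform_within_open[where S="{0<..}"])
      (use greater in \<open>auto simp: flat_exp_def\<close>)
next
  case equal
  have "((\<lambda>h. poly ([:0, 1:] * p) (1 / h) * exp (- (1 / h))) \<longlongrightarrow> 0) (at_right (0::real))"
    using filterlim_compose[OF tendsto_poly_exp_neg[of "[:0, 1:] * p"] filterlim_inverse_at_top_right]
    by (simp add: inverse_eq_divide)
  then have "((\<lambda>h. (flat_exp p (0 + h) - flat_exp p 0) / h) \<longlongrightarrow> 0) (at_right 0)"
    by (rule Lim_transform_eventually)
      (auto simp: eventually_at_filter flat_exp_def intro!: always_eventually)
  moreover have "((\<lambda>h. (flat_exp p (0 + h) - flat_exp p 0) / h) \<longlongrightarrow> 0) (at_left 0)"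
    by (rule tendsto_eventually) (auto simp: eventually_at_filter flat_exp_def)
  ultimately have "((\<lambda>h. (flat_exp p (0 + h) - flat_exp p 0) / h) \<longlongrightarrow> 0) (at 0)"
    by (rule filterlim_split_at[rotated])
  then show ?thesis
    using equal by (simp add: DERIV_def flat_exp_def)
qed

lemma smooth_flat_exp: "smooth (\<lambda>x. complex_of_real (flat_exp p x))"
proof (coinduction arbitrary: p)
  case smooth
  have "((\<lambda>x. complex_of_real (flat_exp p x)) has_vector_derivative
      complex_of_real (flat_exp ([:0, 0, 1:] * (p - pderiv p)) x)) (at x)" for x
    by (intro has_vector_derivative_of_real)
      (use has_field_derivative_flat_exp in \<open>simp add: has_real_derivative_iff_has_vector_derivative\<close>)
  then show ?case
    by (intro exI[of _ "\<lambda>x. complex_of_real (flat_exp p x)"]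
        exI[of _ "\<lambda>x. complex_of_real (flat_exp ([:0, 0, 1:] * (p - pderiv p)) x)"]) blast
qed

section \<open>Square-integrable functions\<close>

lemma sq_integrableD [measurable_dest]: "f \<in> sq_integrable M \<Longrightarrow> f \<in> borel_measurable M"
  and sq_integrable_integrableD: "f \<in> sq_integrable M \<Longrightarrow> integrable M (\<lambda>x. (cmod (f x))\<^sup>2)"
  by (auto simp: sq_integrable_def)

lemma sq_integrableI_bound:
  assumes "f \<in> borel_measurable M" "integrable M h" "AE x in M. (cmod (f x))\<^sup>2 \<le> h x"
  shows "f \<in> sq_integrable M"
  unfolding sq_integrable_def
proof (intro CollectI conjI assms(1))
  show "integrable M (\<lambda>x. (cmod (f x))\<^sup>2)"
    using assms by (intro Bochner_Integration.integrable_bound[OF assms(2)]) (auto elim: eventually_mono)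
qed

text \<open>Squared norms with the constant 2 take the place of Minkowski's inequality wherever only smallness matters.\<close>

lemma cmod_add_sq_le: "(cmod (x + y))\<^sup>2 \<le> 2 * (cmod x)\<^sup>2 + 2 * (cmod y)\<^sup>2"
proof -
  have "(cmod (x + y))\<^sup>2 \<le> (cmod x + cmod y)\<^sup>2"
    by (intro power_mono norm_triangle_ineq) simp
  also have "\<dots> \<le> 2 * (cmod x)\<^sup>2 + 2 * (cmod y)\<^sup>2"
    using sum_squares_bound[of "cmod x" "cmod y"] by (simp add: power2_sum)
  finally show ?thesis .
qed

lemma sq_integrable_add:
  assumes "f \<in> sq_integrable M" "g \<in> sq_integrable M"
  shows "(\<lambda>x. f x + g x) \<in> sq_integrable M"
proof (rule sq_integrableI_bound)
  show "integrable M (\<lambda>x. 2 * (cmod (f x))\<^sup>2 + 2 * (cmod (g x))\<^sup>2)"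
    using assms by (intro Bochner_Integration.integrable_add integrable_mult_right sq_integrable_integrableD)
qed (use assms cmod_add_sq_le in auto)

lemma sq_integrable_bounded_mult:
  assumes "f \<in> sq_integrable M" "h \<in> borel_measurable M" "AE x in M. cmod (h x) \<le> C"
  shows "(\<lambda>x. h x * f x) \<in> sq_integrable M"
proof (rule sq_integrableI_bound)
  show "integrable M (\<lambda>x. C\<^sup>2 * (cmod (f x))\<^sup>2)"
    using assms(1) by (intro integrable_mult_right sq_integrable_integrableD)
  show "AE x in M. (cmod (h x * f x))\<^sup>2 \<le> C\<^sup>2 * (cmod (f x))\<^sup>2"
    using assms(3) by eventually_elim (auto simp: norm_mult power_mult_distrib intro!: mult_right_mono power_mono)
qed (use assms in auto)

lemma sq_integrable_cmult: "f \<in> sq_integrable M \<Longrightarrow> (\<lambda>x. c * f x) \<in> sq_integrable M"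
  by (rule sq_integrable_bounded_mult[where C="cmod c"]) auto

lemma sq_integrable_minus: "f \<in> sq_integrable M \<Longrightarrow> (\<lambda>x. - f x) \<in> sq_integrable M"
  using sq_integrable_cmult[of f M "-1"] by simp

lemma sq_integrable_diff:
  assumes "f \<in> sq_integrable M" "g \<in> sq_integrable M"
  shows "(\<lambda>x. f x - g x) \<in> sq_integrable M"
  using sq_integrable_add[OF assms(1) sq_integrable_minus[OF assms(2)]] by simp

lemma sq_integrable_bounded:
  assumes "finite_measure M" "f \<in> borel_measurable M" "AE x in M. cmod (f x) \<le> C"
  shows "f \<in> sq_integrable M"
proof -
  interpret finite_measure M by fact
  have "(\<lambda>x. 1) \<in> sq_integrable M"
    by (simp add: sq_integrable_def)
  from sq_integrable_bounded_mult[OF this assms(2,3)] show ?thesis by simp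
qed

definition fnorm :: "real measure \<Rightarrow> (real \<Rightarrow> complex) \<Rightarrow> real" where
  "fnorm M f = sqrt (LINT x|M. (cmod (f x))\<^sup>2)"

lemma fnorm_nonneg [simp]: "0 \<le> fnorm M f"
  by (simp add: fnorm_def)

lemma fnorm_sq: "(fnorm M f)\<^sup>2 = (LINT x|M. (cmod (f x))\<^sup>2)"
  by (simp add: fnorm_def)

lemma fnorm_add_sq_le:
  assumes "f \<in> sq_integrable M" "g \<in> sq_integrable M"
  shows "(fnorm M (\<lambda>x. f x + g x))\<^sup>2 \<le> 2 * (fnorm M f)\<^sup>2 + 2 * (fnorm M g)\<^sup>2"
proof -
  note [simp] = sq_integrable_integrableD[OF assms(1)] sq_integrable_integrableD[OF assms(2)]
  have "(LINT x|M. (cmod (f x + g x))\<^sup>2) \<le> (LINT x|M. 2 * (cmod (f x))\<^sup>2 + 2 * (cmod (g x))\<^sup>2)"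
    using sq_integrable_integrableD[OF sq_integrable_add[OF assms]]
    by (intro integral_mono cmod_add_sq_le) auto
  then show ?thesis
    by (simp add: fnorm_sq)
qed

lemma fnorm_cmult: "fnorm M (\<lambda>x. c * f x) = cmod c * fnorm M f"
  by (simp add: fnorm_def norm_mult power_mult_distrib real_sqrt_mult)

lemma fnorm_minus: "fnorm M (\<lambda>x. - f x) = fnorm M f"
  by (simp add: fnorm_def)

lemma integrable_cnj_mult:
  assumes "f \<in> sq_integrable M" "g \<in> sq_integrable M"
  shows "integrable M (\<lambda>x. cnj (f x) * g x)"
proof (rule Bochner_Integration.integrable_bound)
  show "integrable M (\<lambda>x. (cmod (f x))\<^sup>2 + (cmod (g x))\<^sup>2)"
    using assms by (intro Bochner_Integration.integrable_add sq_integrable_integrableD)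
  show "(\<lambda>x. cnj (f x) * g x) \<in> borel_measurable M"
    using assms by (intro borel_measurable_times
          borel_measurable_continuous_on[OF continuous_on_cnj[OF continuous_on_id]] sq_integrableD)
  show "AE x in M. norm (cnj (f x) * g x) \<le> norm ((cmod (f x))\<^sup>2 + (cmod (g x))\<^sup>2)"
  proof (rule AE_I2)
    fix x
    have "2 * (cmod (f x) * cmod (g x)) \<le> (cmod (f x))\<^sup>2 + (cmod (g x))\<^sup>2"
      using sum_squares_bound[of "cmod (f x)" "cmod (g x)"] by (simp add: mult.assoc)
    moreover have "0 \<le> cmod (f x) * cmod (g x)" by simp
    ultimately have "cmod (f x) * cmod (g x) \<le> (cmod (f x))\<^sup>2 + (cmod (g x))\<^sup>2"
      by linarith
    then show "norm (cnj (f x) * g x) \<le> norm ((cmod (f x))\<^sup>2 + (cmod (g x))\<^sup>2)"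
      by (simp add: norm_mult)
  qed
qed

lemma integral_cmod_mult_le:
  assumes f: "f \<in> sq_integrable M" and g: "g \<in> sq_integrable M"
  shows "(LINT x|M. cmod (f x) * cmod (g x)) \<le> fnorm M f * fnorm M g"
proof -
  have [measurable]: "f \<in> borel_measurable M" "g \<in> borel_measurable M"
    using f g by auto
  have int: "integrable M (\<lambda>x. cmod (f x) * cmod (g x))"
    using integrable_norm[OF integrable_cnj_mult[OF f g]] by (simp add: norm_mult)
  have "ennreal ((LINT x|M. cmod (f x) * cmod (g x))\<^sup>2) =
      (\<integral>\<^sup>+x. ennreal (cmod (f x)) * ennreal (cmod (g x)) \<partial>M)\<^sup>2"
    using int by (simp add: nn_integral_eq_integral flip: ennreal_mult ennreal_power)
  also have "\<dots> \<le> (\<integral>\<^sup>+x. (ennreal (cmod (f x)))\<^sup>2 \<partial>M) * (\<integral>\<^sup>+x. (ennreal (cmod (g x)))\<^sup>2 \<partial>M)"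
    by (rule Cauchy_Schwarz_nn_integral) auto
  also have "\<dots> = ennreal ((fnorm M f * fnorm M g)\<^sup>2)"
    using sq_integrable_integrableD[OF f] sq_integrable_integrableD[OF g]
    by (simp add: nn_integral_eq_integral ennreal_power power_mult_distrib fnorm_sq flip: ennreal_mult)
  finally have "(LINT x|M. cmod (f x) * cmod (g x))\<^sup>2 \<le> (fnorm M f * fnorm M g)\<^sup>2"
    by (simp add: ennreal_le_iff)
  then show ?thesis
    by (rule power2_le_imp_le) simp
qed

lemma cmod_integral_cnj_mult_le:
  assumes "f \<in> sq_integrable M" "g \<in> sq_integrable M"
  shows "cmod (LINT x|M. cnj (f x) * g x) \<le> fnorm M f * fnorm M g"
proof -
  have "cmod (LINT x|M. cnj (f x) * g x) \<le> (LINT x|M. cmod (cnj (f x) * g x))"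
    by (rule integral_norm_bound)
  also have "\<dots> \<le> fnorm M f * fnorm M g"
    using integral_cmod_mult_le[OF assms] by (simp add: norm_mult)
  finally show ?thesis .
qed

text \<open>Cauchy-Schwarz against the constant function one.\<close>

lemma sq_integrable_imp_integrable:
  assumes "finite_measure M" "f \<in> sq_integrable M"
  shows "integrable M f"
    and "(LINT x|M. cmod (f x)) \<le> sqrt (measure M (space M)) * fnorm M f"
proof -
  interpret finite_measure M by fact
  have one: "(\<lambda>x. 1) \<in> sq_integrable M"
    by (simp add: sq_integrable_def)
  show "integrable M f"
    using integrable_cnj_mult[OF one assms(2)] by simp
  show "(LINT x|M. cmod (f x)) \<le> sqrt (measure M (space M)) * fnorm M f"
    using integral_cmod_mult_le[OF one assms(2)] by (simp add: fnorm_def)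
qed

section \<open>Density of test functions\<close>

text \<open>Compactness of the support inside the interval amounts to vanishing outside a compact subinterval, which is easier to check for sums and primitives.\<close>

lemma test_funs_iff:
  "\<phi> \<in> test_funs {a<..<b} \<longleftrightarrow>
    smooth \<phi> \<and> (\<exists>c d. a < c \<and> d < b \<and> (\<forall>x. x \<notin> {c..d} \<longrightarrow> \<phi> x = 0))"
proof -
  have "compact (closure {x. \<phi> x \<noteq> 0}) \<and> closure {x. \<phi> x \<noteq> 0} \<subseteq> {a<..<b} \<longleftrightarrow>
      (\<exists>c d. a < c \<and> d < b \<and> (\<forall>x. x \<notin> {c..d} \<longrightarrow> \<phi> x = 0))" (is "?L \<longleftrightarrow> ?R")
  proof
    let ?K = "closure {x. \<phi> x \<noteq> 0}"
    assume L: ?L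
    show ?R
    proof (cases "?K = {}")
      case True
      then have "\<forall>x. \<phi> x = 0" by simp
      then show ?thesis by (intro exI[of _ "a + 1"] exI[of _ "b - 1"]) simp
    next
      case False
      obtain c where c: "c \<in> ?K" "\<And>x. x \<in> ?K \<Longrightarrow> c \<le> x"
        using compact_attains_inf[of ?K] L False by auto
      obtain d where d: "d \<in> ?K" "\<And>x. x \<in> ?K \<Longrightarrow> x \<le> d"
        using compact_attains_sup[of ?K] L False by auto
      have "\<phi> x = 0" if "x \<notin> {c..d}" for x
        using c(2)[of x] d(2)[of x] closure_subset[of "{x. \<phi> x \<noteq> 0}"] that by auto
      then show ?thesis
        using L c(1) d(1) by (intro exI[of _ c] exI[of _ d]) auto
    qed
  next
    assume ?R
    then obtain c d where cd: "a < c" "d < b" "\<And>x. x \<notin> {c..d} \<Longrightarrow> \<phi> x = 0"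
      by blast
    then have "{x. \<phi> x \<noteq> 0} \<subseteq> {c..d}" by blast
    then have "closure {x. \<phi> x \<noteq> 0} \<subseteq> {c..d}"
      by (rule closure_minimal) simp
    then show ?L
      using cd(1,2) compact_Int_closed[of "{c..d}" "closure {x. \<phi> x \<noteq> 0}"]
      by (auto simp: Int_absorb1)
  qed
  then show ?thesis
    unfolding test_funs_def smooth_iff_iterated_derivatives by simp
qed

lemma test_funs_add:
  assumes "\<phi> \<in> test_funs {a<..<b}" "\<psi> \<in> test_funs {a<..<b}"
  shows "(\<lambda>x. \<phi> x + \<psi> x) \<in> test_funs {a<..<b}"
proof -
  obtain c d c' d' where *: "a < c" "d < b" "\<And>x. x \<notin> {c..d} \<Longrightarrow> \<phi> x = 0"
      "a < c'" "d' < b" "\<And>x. x \<notin> {c'..d'} \<Longrightarrow> \<psi> x = 0"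
    using assms unfolding test_funs_iff by metis
  have "\<phi> x + \<psi> x = 0" if "x \<notin> {min c c'..max d d'}" for x
    using *(3)[of x] *(6)[of x] that by (cases "x \<in> {c..d}"; cases "x \<in> {c'..d'}") auto
  then show ?thesis
    using assms * unfolding test_funs_iff
    by (intro conjI smooth_add exI[of _ "min c c'"] exI[of _ "max d d'"]) auto
qed

lemma test_funs_cmult:
  assumes "\<phi> \<in> test_funs {a<..<b}"
  shows "(\<lambda>x. k * \<phi> x) \<in> test_funs {a<..<b}"
  using assms smooth_mult[OF smooth_const] unfolding test_funs_iff by fastforce

lemma test_funs_has_derivative:
  assumes "\<phi> \<in> test_funs I"
  shows "(\<phi> has_vector_derivative vector_derivative \<phi> (at x)) (at x)"
proof -
  have "smooth \<phi>"
    using assms unfolding test_funs_def smooth_iff_iterated_derivatives by simp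
  then show ?thesis by (rule smooth_vector_derivative)
qed

lemma test_funs_derivative:
  assumes "\<phi> \<in> test_funs {a<..<b}"
  shows "(\<lambda>x. vector_derivative \<phi> (at x)) \<in> test_funs {a<..<b}"
proof -
  obtain c d where *: "a < c" "d < b" "\<And>x. x \<notin> {c..d} \<Longrightarrow> \<phi> x = 0"
    using assms unfolding test_funs_iff by blast
  have "vector_derivative \<phi> (at x) = 0" if "x \<notin> {c..d}" for x
  proof -
    have "((\<lambda>_. 0) has_vector_derivative 0) (at x)" by simp
    then have "(\<phi> has_vector_derivative 0) (at x)"
      by (rule has_vector_derivative_transform_within_open[where S = "- {c..d}"])
        (use that * in auto)
    then show ?thesis by (rule vector_derivative_at)
  qed
  then show ?thesis
    using assms * smooth_vector_derivative(2) unfolding test_funs_iff by blast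
qed

lemma continuous_on_test_fun:
  assumes "\<phi> \<in> test_funs I"
  shows "continuous_on S \<phi>"
  using has_vector_derivative_continuous[OF test_funs_has_derivative[OF assms]]
  by (simp add: continuous_at_imp_continuous_on)

lemma finite_measure_interval: "finite_measure (lebesgue_on {a<..<b::real})"
  by (simp add: finite_measure_lebesgue_on bounded_set_imp_lmeasurable)

lemma measure_interval:
  assumes "a \<le> b"
  shows "measure (lebesgue_on {a<..<b::real}) {a<..<b} = b - a"
  using assms by (simp add: measure_restrict_space)

lemma continuous_sq_integrable_interval:
  fixes f :: "real \<Rightarrow> complex"
  assumes "continuous_on UNIV f"
  shows "f \<in> sq_integrable (lebesgue_on {a<..<b})"
proof -
  have "f \<in> borel_measurable (lebesgue_on {a<..<b})"
    by (intro measurable_restrict_space1 measurable_completion)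
      (simp add: assms borel_measurable_continuous_onI)
  moreover have "bounded (f ` {a..b})"
    by (intro compact_imp_bounded compact_continuous_image continuous_on_subset[OF assms]) auto
  then obtain C where "\<forall>x\<in>{a..b}. cmod (f x) \<le> C"
    unfolding bounded_iff by blast
  ultimately show ?thesis
    by (intro sq_integrable_bounded[OF finite_measure_interval, where C = C] AE_I2) auto
qed

lemma test_fun_sq_integrable:
  "\<phi> \<in> test_funs I \<Longrightarrow> \<phi> \<in> sq_integrable (lebesgue_on {a<..<b})"
  by (intro continuous_sq_integrable_interval continuous_on_test_fun)

definition test_approximable :: "real set \<Rightarrow> (real \<Rightarrow> complex) \<Rightarrow> bool" where
  "test_approximable I f \<longleftrightarrow> f \<in> sq_integrable (lebesgue_on I) \<and>
     (\<forall>e>0. \<exists>\<phi>\<in>test_funs I. (fnorm (lebesgue_on I) (\<lambda>x. f x - \<phi> x))\<^sup>2 < e)"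

lemma test_approximable_limit:
  assumes f: "f \<in> sq_integrable (lebesgue_on {a<..<b})"
    and g: "\<And>n. test_approximable {a<..<b} (g n)"
    and lim: "(\<lambda>n. (fnorm (lebesgue_on {a<..<b}) (\<lambda>x. f x - g n x))\<^sup>2) \<longlonglongrightarrow> 0"
  shows "test_approximable {a<..<b} f"
  unfolding test_approximable_def
proof (intro conjI allI impI f)
  let ?M = "lebesgue_on {a<..<b}"
  fix e :: real assume "e > 0"
  then obtain n where n: "(fnorm ?M (\<lambda>x. f x - g n x))\<^sup>2 < e / 4"
    using order_tendstoD(2)[OF lim, of "e / 4"] by (auto simp: eventually_sequentially)
  obtain \<phi> where \<phi>: "\<phi> \<in> test_funs {a<..<b}" "(fnorm ?M (\<lambda>x. g n x - \<phi> x))\<^sup>2 < e / 4"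
    using g[of n] \<open>e > 0\<close> unfolding test_approximable_def by (meson divide_pos_pos zero_less_numeral)
  have gn: "g n \<in> sq_integrable ?M"
    using g[of n] by (simp add: test_approximable_def)
  have "(fnorm ?M (\<lambda>x. (f x - g n x) + (g n x - \<phi> x)))\<^sup>2 < e"
    using fnorm_add_sq_le[OF sq_integrable_diff[OF f gn] sq_integrable_diff[OF gn test_fun_sq_integrable[OF \<phi>(1)]]]
      n \<phi>(2) by linarith
  then show "\<exists>\<phi>\<in>test_funs {a<..<b}. (fnorm ?M (\<lambda>x. f x - \<phi> x))\<^sup>2 < e"
    using \<phi>(1) by (intro bexI[of _ \<phi>]) simp_all
qed

lemma test_approximable_dominated_limit:
  assumes f[measurable]: "f \<in> borel_measurable (lebesgue_on {a<..<b})"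
    and g: "\<And>n. test_approximable {a<..<b} (g n)"
    and lim: "\<And>x. x \<in> {a<..<b} \<Longrightarrow> (\<lambda>n. g n x) \<longlonglongrightarrow> f x"
    and h: "integrable (lebesgue_on {a<..<b}) (\<lambda>x. (h x)\<^sup>2)"
    and bound: "\<And>n x. x \<in> {a<..<b} \<Longrightarrow> cmod (g n x) \<le> h x"
  shows "test_approximable {a<..<b} f"
proof (rule test_approximable_limit[OF _ g])
  let ?M = "lebesgue_on {a<..<b}"
  have g_meas[measurable]: "g n \<in> borel_measurable ?M" for n
    using g[of n] by (auto simp: test_approximable_def)
  have f_bound: "cmod (f x) \<le> h x" if "x \<in> {a<..<b}" for x
    by (rule tendsto_upperbound[OF tendsto_norm[OF lim[OF that]]]) (use bound[OF that] in auto)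
  show "f \<in> sq_integrable ?M"
    by (rule sq_integrableI_bound[OF f h]) (auto intro!: AE_I2 power_mono f_bound)
  have "(\<lambda>n. LINT x|?M. (cmod (f x - g n x))\<^sup>2) \<longlonglongrightarrow> (LINT x|?M. 0)"
  proof (rule integral_dominated_convergence)
    show "integrable ?M (\<lambda>x. 4 * (h x)\<^sup>2)"
      using h by simp
    show "AE x in ?M. (\<lambda>n. (cmod (f x - g n x))\<^sup>2) \<longlonglongrightarrow> 0"
    proof (rule AE_I2)
      fix x assume "x \<in> space ?M"
      then have "(\<lambda>n. (cmod (f x - g n x))\<^sup>2) \<longlonglongrightarrow> (cmod (f x - f x))\<^sup>2"
        by (intro tendsto_intros lim) simp
      then show "(\<lambda>n. (cmod (f x - g n x))\<^sup>2) \<longlonglongrightarrow> 0" by simp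
    qed
    show "AE x in ?M. norm ((cmod (f x - g n x))\<^sup>2) \<le> 4 * (h x)\<^sup>2" for n
    proof (rule AE_I2)
      fix x assume "x \<in> space ?M"
      then have x: "x \<in> {a<..<b}" by simp
      have "cmod (f x - g n x) \<le> 2 * h x"
        using norm_triangle_ineq4[of "f x" "g n x"] f_bound[OF x] bound[OF x, of n] by linarith
      then have "(cmod (f x - g n x))\<^sup>2 \<le> (2 * h x)\<^sup>2"
        by (rule power_mono) simp
      then show "norm ((cmod (f x - g n x))\<^sup>2) \<le> 4 * (h x)\<^sup>2"
        by (simp add: power_mult_distrib)
    qed
  qed auto
  then show "(\<lambda>n. (fnorm ?M (\<lambda>x. f x - g n x))\<^sup>2) \<longlonglongrightarrow> 0"
    by (simp add: fnorm_sq)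
qed

lemma test_approximable_cong_AE:
  assumes "test_approximable I f" "g \<in> borel_measurable (lebesgue_on I)"
    "AE x in lebesgue_on I. f x = g x"
  shows "test_approximable I g"
proof -
  let ?M = "lebesgue_on I"
  have [measurable]: "f \<in> borel_measurable ?M" "g \<in> borel_measurable ?M"
    and f: "f \<in> sq_integrable ?M"
    using assms by (auto simp: test_approximable_def)
  have "g \<in> sq_integrable ?M"
    by (rule sq_integrableI_bound[OF assms(2) sq_integrable_integrableD[OF f]])
      (use assms(3) in \<open>auto elim: eventually_mono\<close>)
  moreover have "fnorm ?M (\<lambda>x. f x - \<phi> x) = fnorm ?M (\<lambda>x. g x - \<phi> x)"
    if "\<phi> \<in> borel_measurable ?M" for \<phi>
    unfolding fnorm_def
    by (intro arg_cong[where f = sqrt] integral_cong_AE)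
      (use assms(3) that in \<open>auto elim: eventually_mono\<close>)
  moreover have "\<phi> \<in> borel_measurable ?M" if "\<phi> \<in> test_funs I" for \<phi>
    by (intro measurable_restrict_space1 measurable_completion)
      (simp add: continuous_on_test_fun[OF that] borel_measurable_continuous_onI)
  ultimately show ?thesis
    using assms(1) unfolding test_approximable_def by metis
qed

lemma test_approximable_add:
  assumes "test_approximable {a<..<b} f" "test_approximable {a<..<b} g"
  shows "test_approximable {a<..<b} (\<lambda>x. f x + g x)"
  unfolding test_approximable_def
proof (intro conjI allI impI)
  let ?M = "lebesgue_on {a<..<b}"
  have f: "f \<in> sq_integrable ?M" and g: "g \<in> sq_integrable ?M"
    using assms by (auto simp: test_approximable_def)
  then show "(\<lambda>x. f x + g x) \<in> sq_integrable ?M"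
    by (rule sq_integrable_add)
  fix e :: real assume "e > 0"
  then have "e / 4 > 0" by simp
  then obtain \<phi> \<psi> where *: "\<phi> \<in> test_funs {a<..<b}" "(fnorm ?M (\<lambda>x. f x - \<phi> x))\<^sup>2 < e / 4"
      "\<psi> \<in> test_funs {a<..<b}" "(fnorm ?M (\<lambda>x. g x - \<psi> x))\<^sup>2 < e / 4"
    using assms unfolding test_approximable_def by meson
  have "(fnorm ?M (\<lambda>x. (f x - \<phi> x) + (g x - \<psi> x)))\<^sup>2 < e"
    using fnorm_add_sq_le[OF sq_integrable_diff[OF f test_fun_sq_integrable[OF *(1)]]
        sq_integrable_diff[OF g test_fun_sq_integrable[OF *(3)]]] * by linarith
  moreover have "(\<lambda>x. (f x - \<phi> x) + (g x - \<psi> x)) = (\<lambda>x. f x + g x - (\<phi> x + \<psi> x))"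
    by (simp add: algebra_simps)
  ultimately show "\<exists>\<phi>\<in>test_funs {a<..<b}. (fnorm ?M (\<lambda>x. f x + g x - \<phi> x))\<^sup>2 < e"
    using test_funs_add[OF *(1,3)] by (intro bexI[of _ "\<lambda>x. \<phi> x + \<psi> x"]) simp_all
qed

lemma test_approximable_cmult:
  assumes "test_approximable {a<..<b} f"
  shows "test_approximable {a<..<b} (\<lambda>x. k * f x)"
  unfolding test_approximable_def
proof (intro conjI allI impI)
  let ?M = "lebesgue_on {a<..<b}"
  have f: "f \<in> sq_integrable ?M"
    using assms by (auto simp: test_approximable_def)
  then show "(\<lambda>x. k * f x) \<in> sq_integrable ?M"
    by (rule sq_integrable_cmult)
  fix e :: real assume "e > 0"
  then have "e / ((cmod k)\<^sup>2 + 1) > 0"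
    by (intro divide_pos_pos) (auto simp: add_nonneg_pos)
  then obtain \<phi> where \<phi>: "\<phi> \<in> test_funs {a<..<b}"
      "(fnorm ?M (\<lambda>x. f x - \<phi> x))\<^sup>2 < e / ((cmod k)\<^sup>2 + 1)"
    using assms unfolding test_approximable_def by meson
  have "(fnorm ?M (\<lambda>x. k * f x - k * \<phi> x))\<^sup>2 = (cmod k)\<^sup>2 * (fnorm ?M (\<lambda>x. f x - \<phi> x))\<^sup>2"
    using fnorm_cmult[of ?M k "\<lambda>x. f x - \<phi> x"] by (simp add: right_diff_distrib power_mult_distrib)
  also have "\<dots> \<le> ((cmod k)\<^sup>2 + 1) * (fnorm ?M (\<lambda>x. f x - \<phi> x))\<^sup>2"
    by (intro mult_right_mono) auto
  also have "\<dots> < e"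
    using \<phi>(2) by (simp add: pos_less_divide_eq add_nonneg_pos mult.commute)
  finally show "\<exists>\<phi>\<in>test_funs {a<..<b}. (fnorm ?M (\<lambda>x. k * f x - \<phi> x))\<^sup>2 < e"
    using test_funs_cmult[OF \<phi>(1), of k] by (intro bexI[of _ "\<lambda>x. k * \<phi> x"]) simp_all
qed

lemma test_approximable_test_fun:
  "\<phi> \<in> test_funs {a<..<b} \<Longrightarrow> test_approximable {a<..<b} \<phi>"
  unfolding test_approximable_def
  by (intro conjI allI impI test_fun_sq_integrable bexI[of _ \<phi>]) (auto simp: fnorm_def)

lemma test_approximable_zero: "test_approximable {a<..<b} (\<lambda>x. 0)"
proof (rule test_approximable_test_fun)
  show "(\<lambda>x. 0) \<in> test_funs {a<..<b}"
    unfolding test_funs_iff using smooth_const by (intro conjI exI[of _ "a + 1"] exI[of _ "b - 1"]) auto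
qed

lemma test_approximable_sum:
  assumes "\<And>i. i \<in> A \<Longrightarrow> test_approximable {a<..<b} (f i)"
  shows "test_approximable {a<..<b} (\<lambda>x. \<Sum>i\<in>A. f i x)"
  using assms
  by (induction A rule: infinite_finite_induct)
    (auto intro: test_approximable_zero test_approximable_add)

lemma interval_bump_test_fun:
  fixes n :: nat and c d :: real
  assumes "n > 0" "a \<le> c" "d \<le> b"
  shows "(\<lambda>x. complex_of_real (flat_exp 1 (real n * x + (- real n * c - 1))) *
      complex_of_real (flat_exp 1 (- real n * x + (real n * d - 1)))) \<in> test_funs {a<..<b}"
  unfolding test_funs_iff
proof (intro conjI exI allI impI)
  let ?e = "1 / real n"
  show "a < c + ?e" "d - ?e < b"
    using assms zero_less_divide_1_iff[of "real n"] by linarith+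
  show "smooth (\<lambda>x. complex_of_real (flat_exp 1 (real n * x + (- real n * c - 1))) *
      complex_of_real (flat_exp 1 (- real n * x + (real n * d - 1))))"
    by (intro smooth_mult smooth_affine[where f = "\<lambda>x. complex_of_real (flat_exp 1 x)"] smooth_flat_exp)
  fix x assume "x \<notin> {c + ?e..d - ?e}"
  then have "real n * x + (- real n * c - 1) \<le> 0 \<or> - real n * x + (real n * d - 1) \<le> 0"
    using assms(1) by (auto simp: field_simps)
  then show "complex_of_real (flat_exp 1 (real n * x + (- real n * c - 1))) *
      complex_of_real (flat_exp 1 (- real n * x + (real n * d - 1))) = 0"
    by (auto simp: flat_exp_def)
qed

lemma flat_exp_one_bounds: "0 \<le> flat_exp 1 x" "flat_exp 1 x \<le> 1"
  by (auto simp: flat_exp_def)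

lemma flat_exp_one_tendsto: "(flat_exp 1 \<longlongrightarrow> 1) at_top"
proof (rule Lim_transform_eventually)
  have "((\<lambda>x::real. exp (- (1 / x))) \<longlongrightarrow> exp (- 0)) at_top"
    by (intro tendsto_intros tendsto_divide_0[OF tendsto_const] filterlim_at_top_imp_at_infinity filterlim_ident)
  then show "((\<lambda>x::real. exp (- (1 / x))) \<longlongrightarrow> 1) at_top" by simp
  show "\<forall>\<^sub>F x in at_top. exp (- (1 / x)) = flat_exp 1 x"
    using eventually_gt_at_top[of 0] by eventually_elim (simp add: flat_exp_def)
qed

lemma flat_exp_scaled_tendsto:
  assumes "t > 0"
  shows "(\<lambda>n. flat_exp 1 (real (Suc n) * t - 1)) \<longlonglongrightarrow> 1"
proof -
  have "filterlim (\<lambda>n. - 1 + real (Suc n) * t) at_top sequentially"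
    by (intro filterlim_tendsto_add_at_top[OF tendsto_const]
        filterlim_at_top_mult_tendsto_pos[OF tendsto_const assms]
        filterlim_compose[OF filterlim_real_sequentially filterlim_Suc])
  from filterlim_compose[OF flat_exp_one_tendsto this] show ?thesis by simp
qed

text \<open>The product of \<open>exp (-1 / (n (x - c) - 1))\<close> and \<open>exp (-1 / (n (d - x) - 1))\<close>, cut off where an exponent stops being negative, is supported in \<open>[c + 1/n, d - 1/n]\<close> and tends to 1 on \<open>(c, d)\<close>. As only values on \<open>(a, b)\<close> count, the interval may first be cut down to a subinterval of it.\<close>

lemma test_approximable_indicator_interval:
  "test_approximable {a<..<b} (indicator {c<..<d})"
proof -
  define c' d' where "c' = max a c" and "d' = min b d"
  define g where "g n x = complex_of_real (flat_exp 1 (real (Suc n) * x + (- real (Suc n) * c' - 1))) *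
      complex_of_real (flat_exp 1 (- real (Suc n) * x + (real (Suc n) * d' - 1)))" for n x
  have g_eq: "g n x = complex_of_real (flat_exp 1 (real (Suc n) * (x - c') - 1)) *
      complex_of_real (flat_exp 1 (real (Suc n) * (d' - x) - 1))" for n x
    unfolding g_def by (simp add: algebra_simps)
  show ?thesis
  proof (rule test_approximable_dominated_limit[where g = g and h = "\<lambda>_. 1"])
    show "test_approximable {a<..<b} (g n)" for n
      unfolding g_def
      by (rule test_approximable_test_fun[OF interval_bump_test_fun]) (auto simp: c'_def d'_def)
    show "integrable (lebesgue_on {a<..<b}) (\<lambda>x. 1\<^sup>2::real)"
      using finite_measure.integrable_const[OF finite_measure_interval] by simp
    show "cmod (g n x) \<le> 1" for n x
      unfolding g_eq using flat_exp_one_bounds by (auto simp: norm_mult intro!: mult_le_one)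
    show "(indicator {c<..<d} :: real \<Rightarrow> complex) \<in> borel_measurable (lebesgue_on {a<..<b})"
      by (intro measurable_restrict_space1 measurable_completion) simp
    fix x assume x: "x \<in> {a<..<b}"
    show "(\<lambda>n. g n x) \<longlonglongrightarrow> indicator {c<..<d} x"
    proof (cases "x \<in> {c<..<d}")
      case True
      then have "0 < x - c'" "0 < d' - x"
        using x by (auto simp: c'_def d'_def)
      then have "(\<lambda>n. g n x) \<longlonglongrightarrow> complex_of_real 1 * complex_of_real 1"
        unfolding g_eq by (intro tendsto_intros flat_exp_scaled_tendsto)
      then show ?thesis using True by simp
    next
      case False
      then have *: "x - c' \<le> 0 \<or> d' - x \<le> 0"
        using x by (auto simp: c'_def d'_def)
      have "flat_exp 1 (real (Suc n) * t - 1) = 0" if "t \<le> 0" for n t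
        using mult_nonneg_nonpos[of "real (Suc n)" t] that by (simp add: flat_exp_def)
      then have "g n x = 0" for n
        unfolding g_eq using * by auto
      then show ?thesis using False by simp
    qed
  qed
qed

text \<open>Dynkin's argument: intervals form a generator closed under intersection, and approximability passes to complements by linearity and to disjoint unions by dominated convergence.\<close>

lemma test_approximable_indicator_borel:
  assumes "B \<in> sets borel"
  shows "test_approximable {a<..<b} (indicator B)"
proof -
  let ?G = "range (\<lambda>(c, d). {c<..<d::real})"
  have meas: "(indicator A :: real \<Rightarrow> complex) \<in> borel_measurable (lebesgue_on {a<..<b})"
    if "A \<in> sigma_sets UNIV ?G" for A
  proof -
    have "A \<in> sets borel"
      using that by (simp add: borel_eq_box box_real)
    then show ?thesis
      by (intro measurable_restrict_space1 measurable_completion) simp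
  qed
  have "Int_stable ?G"
    unfolding Int_stable_def by (auto simp: image_iff Int_greaterThanLessThan intro!: exI[of _ "(_, _)"])
  moreover have "?G \<subseteq> Pow UNIV"
    by simp
  moreover have "B \<in> sigma_sets UNIV ?G"
    using assms by (simp add: borel_eq_box box_real)
  ultimately show ?thesis
  proof (induction rule: sigma_sets_induct_disjoint)
    case (basic A)
    then show ?case by (auto intro: test_approximable_indicator_interval)
  next
    case empty
    then show ?case using test_approximable_zero by (simp add: indicator_def)
  next
    case (compl A)
    have one: "test_approximable {a<..<b} (\<lambda>x. 1)"
      by (rule test_approximable_cong_AE[OF test_approximable_indicator_interval[of a b a b]])
        (auto intro!: AE_I2)
    have "(\<lambda>x. 1 + (- 1) * indicator A x :: complex) = indicator (UNIV - A)"
      by (auto simp: indicator_def)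
    then show ?case
      using test_approximable_add[OF one test_approximable_cmult[OF compl(2), of "- 1"]] by simp
  next
    case (union A)
    show ?case
    proof (rule test_approximable_dominated_limit[where h = "\<lambda>_. 1"])
      show "test_approximable {a<..<b} (\<lambda>x. \<Sum>i<n. indicator (A i) x)" for n
        using union(3) by (rule test_approximable_sum)
      show "(indicator (\<Union>(range A)) :: real \<Rightarrow> complex) \<in> borel_measurable (lebesgue_on {a<..<b})"
        using union(2) by (intro meas sigma_sets.Union) auto
      show "integrable (lebesgue_on {a<..<b}) (\<lambda>x. 1\<^sup>2::real)"
        using finite_measure.integrable_const[OF finite_measure_interval] by simp
      have eq: "(\<Sum>i<n. indicator (A i) x :: complex) = indicator (\<Union>i<n. A i) x" for n x
        using union(1)
        by (subst indicator_UN_disjoint) (auto simp: disjoint_family_on_def)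
      show "cmod (\<Sum>i<n. indicator (A i) x) \<le> 1" for n x
        unfolding eq by (simp add: indicator_def)
      show "(\<lambda>n. \<Sum>i<n. indicator (A i) x :: complex) \<longlonglongrightarrow> indicator (\<Union>(range A)) x" for x
        unfolding eq by (rule LIMSEQ_indicator_UN)
    qed
  qed
qed

lemma test_approximable_indicator:
  assumes "A \<in> sets (lebesgue_on {a<..<b})"
  shows "test_approximable {a<..<b} (indicator A)"
proof -
  have "A \<in> sets lebesgue"
    using assms by (auto simp: sets_restrict_space_iff)
  then obtain S N N' where SN: "A = S \<union> N" "N \<subseteq> N'" "N' \<in> null_sets lborel" "S \<in> sets lborel"
    by (rule sets_completionE)
  have "AE x in lebesgue. x \<notin> N'"
    using SN(3) by (intro AE_not_in null_sets_completionI)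
  then have "AE x in lebesgue_on {a<..<b}. x \<notin> N'"
    by (simp add: AE_restrict_space_iff eventually_mono)
  then have "AE x in lebesgue_on {a<..<b}. indicator S x = (indicator A x :: complex)"
    by eventually_elim (use SN(1,2) in \<open>auto simp: indicator_def\<close>)
  moreover have "(indicator A :: real \<Rightarrow> complex) \<in> borel_measurable (lebesgue_on {a<..<b})"
    using assms by (rule borel_measurable_indicator)
  moreover have "test_approximable {a<..<b} (indicator S)"
    using SN(4) by (intro test_approximable_indicator_borel) simp
  ultimately show ?thesis
    by (blast intro: test_approximable_cong_AE)
qed

text \<open>Simple functions converge pointwise to \<open>f\<close> and are dominated by \<open>2 |f|\<close>, so indicators of measurable sets suffice.\<close>

lemma test_funs_dense_L2:
  assumes f: "f \<in> sq_integrable (lebesgue_on {a<..<b})"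
  shows "test_approximable {a<..<b} f"
proof -
  let ?M = "lebesgue_on {a<..<b}"
  obtain F where F: "\<And>i. simple_function ?M (F i)" "\<forall>x\<in>{a<..<b}. (\<lambda>i. F i x) \<longlonglongrightarrow> f x"
      "\<forall>i. \<forall>x\<in>{a<..<b}. dist (F i x) 0 \<le> 2 * dist (f x) 0"
    using borel_measurable_implies_sequence_metric[OF sq_integrableD[OF f], of 0]
    unfolding space_lebesgue_on by blast
  show ?thesis
  proof (rule test_approximable_dominated_limit[where g = F and h = "\<lambda>x. 2 * cmod (f x)"])
    show "f \<in> borel_measurable ?M" using f by (rule sq_integrableD)
    show "test_approximable {a<..<b} (F n)" for n
    proof (rule test_approximable_cong_AE)
      show "test_approximable {a<..<b}
          (\<lambda>x. \<Sum>y\<in>F n ` space ?M. y * indicator (F n -` {y} \<inter> space ?M) x)"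
        using F(1)[of n] by (intro test_approximable_sum test_approximable_cmult
            test_approximable_indicator simple_functionD)
      show "F n \<in> borel_measurable ?M"
        using F(1) by (rule borel_measurable_simple_function)
      show "AE x in ?M. (\<Sum>y\<in>F n ` space ?M. y * indicator (F n -` {y} \<inter> space ?M) x) = F n x"
      proof (rule AE_I2)
        fix x assume x: "x \<in> space ?M"
        have "(\<Sum>y\<in>F n ` space ?M. y * indicator (F n -` {y} \<inter> space ?M) x) =
            (\<Sum>y\<in>F n ` space ?M. indicator (F n -` {y} \<inter> space ?M) x *\<^sub>R y)"
          by (intro sum.cong) (auto simp: indicator_def)
        also have "\<dots> = F n x"
          by (rule simple_function_indicator_representation_banach[OF F(1) x, symmetric])
        finally show "(\<Sum>y\<in>F n ` space ?M. y * indicator (F n -` {y} \<inter> space ?M) x) = F n x" .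
      qed
    qed
    show "integrable ?M (\<lambda>x. (2 * cmod (f x))\<^sup>2)"
      using sq_integrable_integrableD[OF f] by (simp add: power_mult_distrib)
  qed (use F in auto)
qed

section \<open>Primitives and weak derivatives\<close>

definition primitive :: "real measure \<Rightarrow> (real \<Rightarrow> complex) \<Rightarrow> real \<Rightarrow> complex" where
  "primitive M f x = (LINT t|M. (if t \<le> x then f t else 0))"

lemma borel_measurable_interval_id [measurable]:
  "(\<lambda>x. x) \<in> borel_measurable (lebesgue_on {a<..<b::real})"
  by (intro measurable_restrict_space1 measurable_completion) simp

lemma integrable_primitive_integrand:
  assumes "integrable (lebesgue_on {a<..<b}) f"
  shows "integrable (lebesgue_on {a<..<b}) (\<lambda>t. if t \<le> (x::real) then f t else (0::complex))"
proof (rule Bochner_Integration.integrable_bound[OF assms])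
  have [measurable]: "f \<in> borel_measurable (lebesgue_on {a<..<b})"
    using assms by auto
  show "(\<lambda>t. if t \<le> x then f t else 0) \<in> borel_measurable (lebesgue_on {a<..<b})"
    by measurable
qed auto

lemma primitive_diff:
  assumes "integrable (lebesgue_on {a<..<b}) f" "integrable (lebesgue_on {a<..<b}) g"
  shows "primitive (lebesgue_on {a<..<b}) (\<lambda>t. f t - g t) x =
    primitive (lebesgue_on {a<..<b}) f x - primitive (lebesgue_on {a<..<b}) g x"
  unfolding primitive_def
  by (subst Bochner_Integration.integral_diff[OF integrable_primitive_integrand[OF assms(1)]
        integrable_primitive_integrand[OF assms(2)], symmetric])
    (auto intro!: Bochner_Integration.integral_cong)

lemma cmod_primitive_le:
  assumes "integrable (lebesgue_on {a<..<b}) f"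
  shows "cmod (primitive (lebesgue_on {a<..<b}) f x) \<le> (LINT t|lebesgue_on {a<..<b}. cmod (f t))"
proof -
  let ?M = "lebesgue_on {a<..<b}"
  have "cmod (primitive ?M f x) \<le> (LINT t|?M. cmod (if t \<le> x then f t else 0))"
    unfolding primitive_def by (rule integral_norm_bound)
  also have "\<dots> \<le> (LINT t|?M. cmod (f t))"
    using assms by (intro integral_mono integrable_norm integrable_primitive_integrand) auto
  finally show ?thesis .
qed

lemma borel_measurable_primitive [measurable]:
  assumes [measurable]: "f \<in> borel_measurable (lebesgue_on {a<..<b})"
  shows "primitive (lebesgue_on {a<..<b}) f \<in> borel_measurable (lebesgue_on {a<..<b})"
proof -
  interpret finite_measure "lebesgue_on {a<..<b}" by (rule finite_measure_interval)
  show ?thesis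
    unfolding primitive_def by measurable
qed

lemma primitive_sq_integrable:
  assumes "integrable (lebesgue_on {a<..<b}) f"
  shows "primitive (lebesgue_on {a<..<b}) f \<in> sq_integrable (lebesgue_on {a<..<b})"
  using assms cmod_primitive_le[OF assms]
  by (intro sq_integrable_bounded[OF finite_measure_interval, where C = "LINT t|lebesgue_on {a<..<b}. cmod (f t)"]
      borel_measurable_primitive AE_I2) auto

lemma lebesgue_integral_subinterval:
  fixes g :: "real \<Rightarrow> complex"
  assumes g: "continuous_on UNIV g" and "{s..t} \<subseteq> {a..b}"
  shows "(LINT x|lebesgue_on {a<..<b}. (if x \<in> {s..t} then g x else 0)) = integral {s..t} g"
proof -
  let ?M = "lebesgue_on {a<..<b}"
  have g': "integrable ?M g"
    by (rule sq_integrable_imp_integrable[OF finite_measure_interval continuous_sq_integrable_interval[OF g]])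
  have "integrable ?M (\<lambda>x. if x \<in> {s..t} then g x else 0)"
  proof (rule Bochner_Integration.integrable_bound[OF g'])
    have [measurable]: "g \<in> borel_measurable ?M" using g' by auto
    show "(\<lambda>x. if x \<in> {s..t} then g x else 0) \<in> borel_measurable ?M"
      unfolding atLeastAtMost_iff by measurable
  qed auto
  then have "((\<lambda>x. if x \<in> {s..t} then g x else 0) has_integral
      (LINT x|?M. (if x \<in> {s..t} then g x else 0))) {a<..<b}"
    by (rule has_integral_integral_lebesgue_on) simp
  moreover have "(g has_integral integral {s..t} g) {s..t}"
    by (intro integrable_integral integrable_continuous_real continuous_on_subset[OF g]) simp
  then have "((\<lambda>x. if x \<in> {s..t} then g x else 0) has_integral integral {s..t} g) {a<..<b}"
    using assms(2) by (simp only: has_integral_Icc_iff_Ioo[symmetric] has_integral_restrict)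
  ultimately show ?thesis
    by (rule has_integral_unique)
qed

lemma primitive_continuous:
  fixes g :: "real \<Rightarrow> complex"
  assumes "continuous_on UNIV g" "x \<in> {a<..<b}"
  shows "primitive (lebesgue_on {a<..<b}) g x = integral {a..x} g"
  unfolding primitive_def
  using assms(2) by (subst lebesgue_integral_subinterval[OF assms(1), of a x a b, symmetric])
    (auto intro!: Bochner_Integration.integral_cong)

lemma primitive_test_fun_derivative:
  assumes "\<phi> \<in> test_funs {a<..<b}" "x \<in> {a<..<b}"
  shows "primitive (lebesgue_on {a<..<b}) (\<lambda>t. vector_derivative \<phi> (at t)) x = \<phi> x"
proof -
  have "\<phi> a = 0"
    using assms(1) unfolding test_funs_iff by force
  have "((\<lambda>t. vector_derivative \<phi> (at t)) has_integral (\<phi> x - \<phi> a)) {a..x}"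
    using assms(2) by (intro fundamental_theorem_of_calculus)
      (auto intro: has_vector_derivative_at_within test_funs_has_derivative[OF assms(1)])
  then show ?thesis
    using \<open>\<phi> a = 0\<close>
    by (simp add: primitive_continuous[OF continuous_on_test_fun[OF test_funs_derivative[OF assms(1)]] assms(2)]
        integral_unique)
qed

text \<open>The mean value zero is exactly what makes the primitive vanish again to the right of the support, hence a test function.\<close>

lemma test_fun_antiderivative:
  assumes "a < b" and \<psi>: "\<psi> \<in> test_funs {a<..<b}" and zero: "(LINT x|lebesgue_on {a<..<b}. \<psi> x) = 0"
  shows "\<exists>\<phi>\<in>test_funs {a<..<b}. (\<forall>x. vector_derivative \<phi> (at x) = \<psi> x) \<and>
    (\<forall>x\<in>{a<..<b}. \<phi> x = primitive (lebesgue_on {a<..<b}) \<psi> x)"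
proof -
  let ?M = "lebesgue_on {a<..<b}"
  define \<phi> where "\<phi> x = integral {a..x} \<psi>" for x
  obtain c d where cd: "a < c" "d < b" "\<And>x. x \<notin> {c..d} \<Longrightarrow> \<psi> x = 0" and sm: "smooth \<psi>"
    using \<psi> unfolding test_funs_iff by blast
  have cont: "continuous_on S \<psi>" for S
    by (rule continuous_on_test_fun[OF \<psi>])
  have left: "\<phi> x = 0" if "x < c" for x
    unfolding \<phi>_def using that cd(3) by (intro integral_unique has_integral_is_0) auto
  have "integral {a..b} \<psi> = 0"
  proof -
    have "(LINT x|?M. (if x \<in> {a..b} then \<psi> x else 0)) = (LINT x|?M. \<psi> x)"
      by (intro Bochner_Integration.integral_cong) auto
    then show ?thesis
      using lebesgue_integral_subinterval[OF cont, of a b a b] zero by simp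
  qed
  have right: "\<phi> x = 0" if "d < x" for x
  proof (cases "x < a")
    case True
    then show ?thesis by (simp add: \<phi>_def)
  next
    case False
    have "\<phi> x = integral {a..max b x} \<psi> - integral {x..max b x} \<psi>"
      unfolding \<phi>_def using False
      by (subst Henstock_Kurzweil_Integration.integral_combine[of a x "max b x", symmetric])
        (auto intro!: integrable_continuous_real cont)
    also have "integral {a..max b x} \<psi> = integral {a..b} \<psi> + integral {b..max b x} \<psi>"
      using \<open>a < b\<close>
      by (subst Henstock_Kurzweil_Integration.integral_combine[of a b "max b x", symmetric])
        (auto intro!: integrable_continuous_real cont)
    also have "integral {b..max b x} \<psi> = 0"
      using cd by (intro integral_unique has_integral_is_0) auto
    also have "integral {x..max b x} \<psi> = 0"
      using cd that by (intro integral_unique has_integral_is_0) auto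
    finally show ?thesis
      using \<open>integral {a..b} \<psi> = 0\<close> by simp
  qed
  have deriv: "(\<phi> has_vector_derivative \<psi> x) (at x)" for x
  proof (cases "x \<in> {a<..<b}")
    case True
    then have "(\<phi> has_vector_derivative \<psi> x) (at x within {a..b})"
      unfolding \<phi>_def by (intro integral_has_vector_derivative cont) auto
    then show ?thesis
      using True at_within_Icc_at[of a x b] by (simp only: greaterThanLessThan_iff)
  next
    case False
    then have x: "x \<in> {..<c} \<union> {d<..}" and \<psi>x: "\<psi> x = 0"
      using cd by auto
    have "((\<lambda>_. 0) has_vector_derivative \<psi> x) (at x)"
      by (simp add: \<psi>x)
    then show ?thesis
      by (rule has_vector_derivative_transform_within_open[where S = "{..<c} \<union> {d<..}"])
        (use x left right in auto)
  qed
  have "\<phi> \<in> test_funs {a<..<b}"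
    unfolding test_funs_iff
  proof (intro conjI exI allI impI)
    show "smooth \<phi>" by (rule smoothI[OF deriv sm])
    \<comment> \<open>Left of \<open>c\<close> because the integrand vanishes there, right of \<open>d\<close> because the total integral vanishes.\<close>
    show "\<phi> x = 0" if "x \<notin> {c..d}" for x
      using that left[of x] right[of x] by (cases "x < c") auto
  qed (use cd in auto)
  moreover have "\<phi> x = primitive ?M \<psi> x" if "x \<in> {a<..<b}" for x
    unfolding \<phi>_def by (rule primitive_continuous[OF cont that, symmetric])
  ultimately show ?thesis
    using vector_derivative_at[OF deriv] by blast
qed

text \<open>Fubini's theorem on the triangle \<open>t \<le> x\<close>: the inner integral of \<open>\<phi>'\<close> over \<open>(t, b)\<close> is \<open>- \<phi>(t)\<close>.\<close>

lemma integral_by_parts_primitive: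
  assumes \<phi>: "\<phi> \<in> test_funs {a<..<b}" and f: "integrable (lebesgue_on {a<..<b}) f"
  shows "(LINT x|lebesgue_on {a<..<b}. cnj (vector_derivative \<phi> (at x)) * primitive (lebesgue_on {a<..<b}) f x) =
    - (LINT x|lebesgue_on {a<..<b}. cnj (\<phi> x) * f x)"
proof -
  let ?M = "lebesgue_on {a<..<b}"
  define g where "g x = cnj (vector_derivative \<phi> (at x))" for x
  interpret finite_measure ?M by (rule finite_measure_interval)
  interpret pair_sigma_finite ?M ?M ..
  have cont: "continuous_on UNIV g"
    unfolding g_def by (intro continuous_intros continuous_on_test_fun[OF test_funs_derivative[OF \<phi>]])
  have g: "integrable ?M g"
    by (rule sq_integrable_imp_integrable[OF finite_measure_interval continuous_sq_integrable_interval[OF cont]])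
  have [measurable]: "f \<in> borel_measurable ?M" "g \<in> borel_measurable ?M"
    using f g by auto
  have "\<phi> b = 0"
    using \<phi> unfolding test_funs_iff by force
  have inner: "(LINT x|?M. (if t \<le> x then g x else 0)) = - cnj (\<phi> t)" if t: "t \<in> {a<..<b}" for t
  proof -
    have "((\<lambda>x. cnj (\<phi> x)) has_vector_derivative g x) (at x)" for x
      unfolding g_def
      by (rule bounded_linear.has_vector_derivative[OF bounded_linear_cnj test_funs_has_derivative[OF \<phi>]])
    then have "(g has_integral cnj (\<phi> b) - cnj (\<phi> t)) {t..b}"
      using t by (intro fundamental_theorem_of_calculus) (auto intro: has_vector_derivative_at_within)
    then have "integral {t..b} g = - cnj (\<phi> t)"
      using \<open>\<phi> b = 0\<close> by (simp add: integral_unique)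
    moreover have "(LINT x|?M. (if t \<le> x then g x else 0)) = (LINT x|?M. (if x \<in> {t..b} then g x else 0))"
      by (intro Bochner_Integration.integral_cong) auto
    ultimately show ?thesis
      using lebesgue_integral_subinterval[OF cont, of t b a b] t by simp
  qed
  have "integrable (?M \<Otimes>\<^sub>M ?M) (\<lambda>(x, t). g x * (if t \<le> x then f t else 0))"
  proof (rule Fubini_integrable)
    show "(\<lambda>(x, t). g x * (if t \<le> x then f t else 0)) \<in> borel_measurable (?M \<Otimes>\<^sub>M ?M)"
      by measurable
    show "AE x in ?M. integrable ?M (\<lambda>t. case (x, t) of (x, t) \<Rightarrow> g x * (if t \<le> x then f t else 0))"
      using integrable_primitive_integrand[OF f] by (intro AE_I2) auto
    show "integrable ?M (\<lambda>x. LINT t|?M. norm (case (x, t) of (x, t) \<Rightarrow> g x * (if t \<le> x then f t else 0)))"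
    proof (rule Bochner_Integration.integrable_bound)
      show "integrable ?M (\<lambda>x. cmod (g x) * (LINT t|?M. cmod (f t)))"
        using g by simp
      show "(\<lambda>x. LINT t|?M. norm (case (x, t) of (x, t) \<Rightarrow> g x * (if t \<le> x then f t else 0))) \<in> borel_measurable ?M"
        by measurable
      show "AE x in ?M. norm (LINT t|?M. norm (case (x, t) of (x, t) \<Rightarrow> g x * (if t \<le> x then f t else 0)))
          \<le> norm (cmod (g x) * (LINT t|?M. cmod (f t)))"
      proof (rule AE_I2)
        fix x
        have "(LINT t|?M. cmod (if t \<le> x then f t else 0)) \<le> (LINT t|?M. cmod (f t))"
          using f by (intro integral_mono integrable_norm integrable_primitive_integrand) auto
        then show "norm (LINT t|?M. norm (case (x, t) of (x, t) \<Rightarrow> g x * (if t \<le> x then f t else 0)))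
          \<le> norm (cmod (g x) * (LINT t|?M. cmod (f t)))"
          by (simp add: norm_mult abs_mult mult_left_mono)
      qed
    qed
  qed
  then have "(LINT x|?M. LINT t|?M. g x * (if t \<le> x then f t else 0)) =
      (LINT t|?M. LINT x|?M. g x * (if t \<le> x then f t else 0))"
    by (rule Fubini_integral[symmetric])
  also have "(LINT x|?M. LINT t|?M. g x * (if t \<le> x then f t else 0)) =
      (LINT x|?M. g x * primitive ?M f x)"
    unfolding primitive_def by simp
  also have "(LINT t|?M. LINT x|?M. g x * (if t \<le> x then f t else 0)) =
      (LINT t|?M. f t * (LINT x|?M. (if t \<le> x then g x else 0)))"
  proof (intro Bochner_Integration.integral_cong refl)
    fix t
    have "(\<lambda>x. g x * (if t \<le> x then f t else 0)) = (\<lambda>x. f t * (if t \<le> x then g x else 0))"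
      by auto
    then show "(LINT x|?M. g x * (if t \<le> x then f t else 0)) = f t * (LINT x|?M. (if t \<le> x then g x else 0))"
      by simp
  qed
  also have "\<dots> = (LINT t|?M. - (cnj (\<phi> t) * f t))"
    by (intro Bochner_Integration.integral_cong) (auto simp: inner)
  also have "\<dots> = - (LINT t|?M. cnj (\<phi> t) * f t)"
    by simp
  finally show ?thesis
    unfolding g_def .
qed

text \<open>The relation between representatives that defines the adjoint of differentiation: \<open>f\<close> is minus the weak derivative of \<open>q\<close>.\<close>

definition weak_adjoint :: "real set \<Rightarrow> (real \<Rightarrow> complex) \<Rightarrow> (real \<Rightarrow> complex) \<Rightarrow> bool" where
  "weak_adjoint I q f \<longleftrightarrow> q \<in> sq_integrable (lebesgue_on I) \<and> f \<in> sq_integrable (lebesgue_on I) \<and>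
     (\<forall>\<phi>\<in>test_funs I. (LINT x|lebesgue_on I. cnj (vector_derivative \<phi> (at x)) * q x) =
        (LINT x|lebesgue_on I. cnj (\<phi> x) * f x))"

lemma integral_test_fun_derivative:
  assumes "\<phi> \<in> test_funs {a<..<b}"
  shows "(LINT x|lebesgue_on {a<..<b}. vector_derivative \<phi> (at x)) = 0"
proof (cases "a \<le> b")
  case True
  have "\<phi> a = 0" "\<phi> b = 0"
    using assms unfolding test_funs_iff by force+
  moreover have "((\<lambda>t. vector_derivative \<phi> (at t)) has_integral (\<phi> b - \<phi> a)) {a..b}"
    using True by (intro fundamental_theorem_of_calculus)
      (auto intro: has_vector_derivative_at_within test_funs_has_derivative[OF assms])
  ultimately have "integral {a..b} (\<lambda>t. vector_derivative \<phi> (at t)) = 0"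
    by (simp add: integral_unique)
  moreover have "(LINT x|lebesgue_on {a<..<b}. vector_derivative \<phi> (at x)) =
      (LINT x|lebesgue_on {a<..<b}. (if x \<in> {a..b} then vector_derivative \<phi> (at x) else 0))"
    by (intro Bochner_Integration.integral_cong) auto
  ultimately show ?thesis
    by (simp only: lebesgue_integral_subinterval[OF continuous_on_test_fun[OF test_funs_derivative[OF assms]]] order_refl)
qed simp

lemma weak_adjoint_primitive:
  assumes f: "f \<in> sq_integrable (lebesgue_on {a<..<b})"
  shows "weak_adjoint {a<..<b} (\<lambda>x. c - primitive (lebesgue_on {a<..<b}) f x) f"
  unfolding weak_adjoint_def
proof (intro conjI ballI f)
  let ?M = "lebesgue_on {a<..<b}"
  have f': "integrable ?M f"
    by (rule sq_integrable_imp_integrable[OF finite_measure_interval f])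
  note prim = primitive_sq_integrable[OF f']
  have const: "(\<lambda>x. c) \<in> sq_integrable ?M"
    by (rule continuous_sq_integrable_interval) simp
  show "(\<lambda>x. c - primitive ?M f x) \<in> sq_integrable ?M"
    by (rule sq_integrable_diff[OF const prim])
  fix \<phi> assume \<phi>: "\<phi> \<in> test_funs {a<..<b}"
  note d = test_fun_sq_integrable[OF test_funs_derivative[OF \<phi>], of a b]
  have "(LINT x|?M. cnj (vector_derivative \<phi> (at x)) * (c - primitive ?M f x)) =
      (LINT x|?M. cnj (vector_derivative \<phi> (at x)) * c) -
      (LINT x|?M. cnj (vector_derivative \<phi> (at x)) * primitive ?M f x)"
    unfolding right_diff_distrib
    by (rule Bochner_Integration.integral_diff[OF integrable_cnj_mult[OF d const] integrable_cnj_mult[OF d prim]])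
  also have "(LINT x|?M. cnj (vector_derivative \<phi> (at x)) * c) = 0"
    using integral_test_fun_derivative[OF \<phi>] by simp
  finally show "(LINT x|?M. cnj (vector_derivative \<phi> (at x)) * (c - primitive ?M f x)) =
      (LINT x|?M. cnj (\<phi> x) * f x)"
    by (simp add: integral_by_parts_primitive[OF \<phi> f'])
qed

lemma AE_zero_if_fnorm_zero:
  assumes "f \<in> sq_integrable M" "fnorm M f = 0"
  shows "AE x in M. f x = 0"
proof -
  have "(LINT x|M. (cmod (f x))\<^sup>2) = 0"
    using assms(2) by (simp add: fnorm_def)
  then have "AE x in M. (cmod (f x))\<^sup>2 = 0"
    by (subst integral_nonneg_eq_0_iff_AE[symmetric]) (use sq_integrable_integrableD[OF assms(1)] in auto)
  then show ?thesis by eventually_elim simp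
qed

text \<open>If \<open>h\<close> were nonzero, some test function would be closer to \<open>h\<close> than \<open>\<parallel>h\<parallel>\<close>; but orthogonality gives \<open>\<parallel>h\<parallel>\<^sup>2 = \<langle>h - \<phi>, h\<rangle> \<le> \<parallel>h - \<phi>\<parallel> \<parallel>h\<parallel>\<close>.\<close>

lemma AE_zero_if_orthogonal_test_funs:
  assumes h: "h \<in> sq_integrable (lebesgue_on {a<..<b})"
    and orth: "\<And>\<phi>. \<phi> \<in> test_funs {a<..<b} \<Longrightarrow> (LINT x|lebesgue_on {a<..<b}. cnj (\<phi> x) * h x) = 0"
  shows "AE x in lebesgue_on {a<..<b}. h x = 0"
proof (rule AE_zero_if_fnorm_zero[OF h], rule ccontr)
  let ?M = "lebesgue_on {a<..<b}"
  assume "fnorm ?M h \<noteq> 0"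
  then have pos: "fnorm ?M h > 0"
    using fnorm_nonneg[of ?M h] by linarith
  then obtain \<phi> where \<phi>: "\<phi> \<in> test_funs {a<..<b}" "(fnorm ?M (\<lambda>x. h x - \<phi> x))\<^sup>2 < (fnorm ?M h)\<^sup>2"
    using test_funs_dense_L2[OF h] unfolding test_approximable_def by (meson zero_less_power)
  have \<phi>sq: "\<phi> \<in> sq_integrable ?M"
    by (rule test_fun_sq_integrable[OF \<phi>(1)])
  have less: "fnorm ?M (\<lambda>x. h x - \<phi> x) < fnorm ?M h"
    using \<phi>(2) by (rule power2_less_imp_less) simp
  have "complex_of_real ((fnorm ?M h)\<^sup>2) = (LINT x|?M. cnj (h x) * h x)"
    unfolding fnorm_sq
    by (simp only: complex_norm_square mult.commute flip: integral_complex_of_real)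
  also have "\<dots> = (LINT x|?M. cnj (h x - \<phi> x) * h x)"
    using integrable_cnj_mult[OF h h] integrable_cnj_mult[OF \<phi>sq h] orth[OF \<phi>(1)]
    by (simp add: left_diff_distrib)
  finally have "(fnorm ?M h)\<^sup>2 = cmod (LINT x|?M. cnj (h x - \<phi> x) * h x)"
    by (metis abs_of_nonneg norm_of_real zero_le_power2)
  also have "\<dots> \<le> fnorm ?M (\<lambda>x. h x - \<phi> x) * fnorm ?M h"
    by (intro cmod_integral_cnj_mult_le sq_integrable_diff h \<phi>sq)
  also have "\<dots> < (fnorm ?M h)\<^sup>2"
    using less pos by (simp add: power2_eq_square)
  finally show False by simp
qed

lemma weak_adjoint_unique:
  assumes q: "weak_adjoint {a<..<b} q f" and q': "weak_adjoint {a<..<b} q' f'"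
    and eq: "AE x in lebesgue_on {a<..<b}. q x = q' x"
  shows "AE x in lebesgue_on {a<..<b}. f x = f' x"
proof -
  let ?M = "lebesgue_on {a<..<b}"
  have sq: "q \<in> sq_integrable ?M" "f \<in> sq_integrable ?M" "q' \<in> sq_integrable ?M" "f' \<in> sq_integrable ?M"
    using q q' by (auto simp: weak_adjoint_def)
  have "AE x in ?M. f x - f' x = 0"
  proof (rule AE_zero_if_orthogonal_test_funs)
    show "(\<lambda>x. f x - f' x) \<in> sq_integrable ?M"
      by (intro sq_integrable_diff sq)
    fix \<phi> assume \<phi>: "\<phi> \<in> test_funs {a<..<b}"
    note d = test_fun_sq_integrable[OF \<phi>, of a b] test_fun_sq_integrable[OF test_funs_derivative[OF \<phi>], of a b]
    have "(LINT x|?M. cnj (\<phi> x) * f x) = (LINT x|?M. cnj (vector_derivative \<phi> (at x)) * q x)"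
      using q \<phi> by (simp add: weak_adjoint_def)
    also have "\<dots> = (LINT x|?M. cnj (vector_derivative \<phi> (at x)) * q' x)"
      using eq by (intro integral_cong_AE borel_measurable_integrable integrable_cnj_mult d sq) (auto elim: eventually_mono)
    also have "\<dots> = (LINT x|?M. cnj (\<phi> x) * f' x)"
      using q' \<phi> by (simp add: weak_adjoint_def)
    finally show "(LINT x|?M. cnj (\<phi> x) * (f x - f' x)) = 0"
      using integrable_cnj_mult[OF d(1) sq(2)] integrable_cnj_mult[OF d(1) sq(4)]
      by (simp add: right_diff_distrib)
  qed
  then show ?thesis by eventually_elim simp
qed

lemma weak_adjoint_diff:
  assumes "weak_adjoint I q f" "weak_adjoint I q' f'" "I = {a<..<b}"
  shows "weak_adjoint I (\<lambda>x. q x - q' x) (\<lambda>x. f x - f' x)"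
proof -
  let ?M = "lebesgue_on {a<..<b}"
  have sq: "q \<in> sq_integrable ?M" "f \<in> sq_integrable ?M" "q' \<in> sq_integrable ?M" "f' \<in> sq_integrable ?M"
    using assms by (auto simp: weak_adjoint_def)
  show ?thesis
    unfolding weak_adjoint_def \<open>I = {a<..<b}\<close>
  proof (intro conjI ballI sq_integrable_diff sq)
    fix \<phi> assume \<phi>: "\<phi> \<in> test_funs {a<..<b}"
    note d = test_fun_sq_integrable[OF \<phi>, of a b] test_fun_sq_integrable[OF test_funs_derivative[OF \<phi>], of a b]
    show "(LINT x|?M. cnj (vector_derivative \<phi> (at x)) * (q x - q' x)) = (LINT x|?M. cnj (\<phi> x) * (f x - f' x))"
      using assms \<phi> integrable_cnj_mult[OF d(1) sq(2)] integrable_cnj_mult[OF d(1) sq(4)]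
        integrable_cnj_mult[OF d(2) sq(1)] integrable_cnj_mult[OF d(2) sq(3)]
      by (simp add: right_diff_distrib weak_adjoint_def)
  qed
qed

lemma weak_adjoint_cong_AE:
  assumes "weak_adjoint {a<..<b} q f" "r \<in> sq_integrable (lebesgue_on {a<..<b})"
    "g \<in> sq_integrable (lebesgue_on {a<..<b})"
    "AE x in lebesgue_on {a<..<b}. q x = r x" "AE x in lebesgue_on {a<..<b}. f x = g x"
  shows "weak_adjoint {a<..<b} r g"
proof -
  let ?M = "lebesgue_on {a<..<b}"
  have sq: "q \<in> sq_integrable ?M" "f \<in> sq_integrable ?M"
    using assms by (auto simp: weak_adjoint_def)
  show ?thesis
    unfolding weak_adjoint_def
  proof (intro conjI ballI assms)
    fix \<phi> assume \<phi>: "\<phi> \<in> test_funs {a<..<b}"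
    note d = test_fun_sq_integrable[OF \<phi>, of a b] test_fun_sq_integrable[OF test_funs_derivative[OF \<phi>], of a b]
    have "(LINT x|?M. cnj (vector_derivative \<phi> (at x)) * q x) = (LINT x|?M. cnj (vector_derivative \<phi> (at x)) * r x)"
      using assms(4) by (intro integral_cong_AE borel_measurable_integrable integrable_cnj_mult d sq assms)
        (auto elim: eventually_mono)
    moreover have "(LINT x|?M. cnj (\<phi> x) * f x) = (LINT x|?M. cnj (\<phi> x) * g x)"
      using assms(5) by (intro integral_cong_AE borel_measurable_integrable integrable_cnj_mult d sq assms)
        (auto elim: eventually_mono)
    ultimately show "(LINT x|?M. cnj (vector_derivative \<phi> (at x)) * r x) = (LINT x|?M. cnj (\<phi> x) * g x)"
      using assms(1) \<phi> by (simp add: weak_adjoint_def)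
  qed
qed

lemma weak_adjoint_test_fun:
  assumes "\<phi> \<in> test_funs {a<..<b}"
  shows "weak_adjoint {a<..<b} \<phi> (\<lambda>x. - vector_derivative \<phi> (at x))"
proof (rule weak_adjoint_cong_AE)
  let ?M = "lebesgue_on {a<..<b}"
  have d: "(\<lambda>x. - vector_derivative \<phi> (at x)) \<in> sq_integrable ?M"
    by (intro sq_integrable_minus test_fun_sq_integrable[OF test_funs_derivative[OF assms]])
  show "weak_adjoint {a<..<b} (\<lambda>x. 0 - primitive ?M (\<lambda>x. - vector_derivative \<phi> (at x)) x)
      (\<lambda>x. - vector_derivative \<phi> (at x))"
    by (rule weak_adjoint_primitive[OF d])
  show "(\<lambda>x. - vector_derivative \<phi> (at x)) \<in> sq_integrable ?M"
    by (rule d)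
  show "\<phi> \<in> sq_integrable ?M"
    by (rule test_fun_sq_integrable[OF assms])
  have "primitive ?M (\<lambda>x. - vector_derivative \<phi> (at x)) x = - primitive ?M (\<lambda>x. vector_derivative \<phi> (at x)) x" for x
  proof -
    have "(\<lambda>t. if t \<le> x then - vector_derivative \<phi> (at t) else 0) =
        (\<lambda>t. - (if t \<le> x then vector_derivative \<phi> (at t) else 0))"
      by auto
    then show ?thesis
      unfolding primitive_def by simp
  qed
  then show "AE x in ?M. 0 - primitive ?M (\<lambda>x. - vector_derivative \<phi> (at x)) x = \<phi> x"
    by (intro AE_I2) (simp add: primitive_test_fun_derivative[OF assms])
qed simp

section \<open>Square-integrable classes and the adjoint of differentiation\<close>

lemma L2_rep:
  assumes "X \<in> L2 M"
  shows rep_sq_integrable: "rep X \<in> sq_integrable M" and cls_rep: "cls M (rep X) = X"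
proof -
  obtain f where f: "f \<in> sq_integrable M" "X = cls M f"
    using assms unfolding L2_def cls_def by (auto elim: quotientE)
  then show "rep X \<in> sq_integrable M"
    using rep_cls(1) by simp
  have "(f, rep X) \<in> ae_eq M"
    using rep_cls[OF f(1)] f unfolding ae_eq_def by (auto elim: eventually_mono)
  then show "cls M (rep X) = X"
    unfolding f(2) cls_def by (metis equiv_ae_eq equiv_class_eq f(2) cls_def)
qed

lemma cls_eqI:
  assumes "f \<in> sq_integrable M" "g \<in> sq_integrable M" "AE x in M. f x = g x"
  shows "cls M f = cls M g"
  unfolding cls_def by (rule equiv_class_eq[OF equiv_ae_eq]) (use assms in \<open>simp add: ae_eq_def\<close>)

lemma cls_eqD:
  assumes "f \<in> sq_integrable M" "g \<in> sq_integrable M" "cls M f = cls M g"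
  shows "AE x in M. f x = g x"
  using rep_cls(2)[OF assms(1)] rep_cls(2)[OF assms(2)] unfolding assms(3)
  by eventually_elim simp

lemma l2_diff_cls:
  assumes "f \<in> sq_integrable M" "g \<in> sq_integrable M"
  shows "l2_diff M (cls M f) (cls M g) = cls M (\<lambda>x. f x - g x)"
  unfolding l2_diff_def
  by (rule cls_eqI) (use rep_cls[OF assms(1)] rep_cls[OF assms(2)] in
      \<open>auto intro!: sq_integrable_diff assms elim: eventually_elim2\<close>)

lemma l2_norm_cls_fnorm: "f \<in> sq_integrable M \<Longrightarrow> l2_norm M (cls M f) = fnorm M f"
  by (simp add: l2_norm_cls fnorm_def)

lemma l2_inner_commute: "l2_inner M X Y = cnj (l2_inner M Y X)"
proof -
  have "cnj (l2_inner M Y X) = (LINT x|M. cnj (cnj (rep Y x) * rep X x))"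
    unfolding l2_inner_def by (rule Bochner_Integration.integral_cnj[symmetric])
  then show ?thesis
    by (simp add: l2_inner_def mult.commute)
qed

text \<open>The operator picks some test function from the class. Two such choices agree almost everywhere, hence so do their weak derivatives, and the class of the derivative does not depend on the choice.\<close>

lemma D_op_cls:
  assumes \<phi>: "\<phi> \<in> test_funs {a<..<b}"
  shows "D_op {a<..<b} (cls (lebesgue_on {a<..<b}) \<phi>) =
    cls (lebesgue_on {a<..<b}) (\<lambda>x. vector_derivative \<phi> (at x))"
proof -
  let ?M = "lebesgue_on {a<..<b}"
  define \<psi> where "\<psi> = (SOME f. f \<in> test_funs {a<..<b} \<and> cls ?M f = cls ?M \<phi>)"
  have "\<psi> \<in> test_funs {a<..<b} \<and> cls ?M \<psi> = cls ?M \<phi>"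
    unfolding \<psi>_def by (rule someI[of _ \<phi>]) (simp add: \<phi>)
  then have \<psi>: "\<psi> \<in> test_funs {a<..<b}" and eq: "cls ?M \<psi> = cls ?M \<phi>"
    by auto
  have "AE x in ?M. \<psi> x = \<phi> x"
    by (intro cls_eqD test_fun_sq_integrable eq) (rule \<psi> \<phi>)+
  then have "AE x in ?M. - vector_derivative \<psi> (at x) = - vector_derivative \<phi> (at x)"
    by (rule weak_adjoint_unique[OF weak_adjoint_test_fun[OF \<psi>] weak_adjoint_test_fun[OF \<phi>]])
  then have "AE x in ?M. vector_derivative \<psi> (at x) = vector_derivative \<phi> (at x)"
    by simp
  then have "cls ?M (\<lambda>x. vector_derivative \<psi> (at x)) = cls ?M (\<lambda>x. vector_derivative \<phi> (at x))"
    by (rule cls_eqI[OF test_fun_sq_integrable[OF test_funs_derivative[OF \<psi>]]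
          test_fun_sq_integrable[OF test_funs_derivative[OF \<phi>]]])
  then show ?thesis
    unfolding D_op_def \<psi>_def .
qed

lemma adjoint_relation_iff:
  assumes Y: "Y \<in> L2 (lebesgue_on {a<..<b})" and Z: "Z \<in> L2 (lebesgue_on {a<..<b})"
  shows "(\<forall>X\<in>D_dom {a<..<b}. l2_inner (lebesgue_on {a<..<b}) (D_op {a<..<b} X) Y =
      l2_inner (lebesgue_on {a<..<b}) X Z) \<longleftrightarrow> weak_adjoint {a<..<b} (rep Y) (rep Z)"
proof -
  let ?M = "lebesgue_on {a<..<b}"
  have "l2_inner ?M (D_op {a<..<b} (cls ?M \<phi>)) Y = (LINT x|?M. cnj (vector_derivative \<phi> (at x)) * rep Y x)"
    "l2_inner ?M (cls ?M \<phi>) Z = (LINT x|?M. cnj (\<phi> x) * rep Z x)" if \<phi>: "\<phi> \<in> test_funs {a<..<b}" for \<phi>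
    using l2_inner_cls[OF test_fun_sq_integrable[OF test_funs_derivative[OF \<phi>]] rep_sq_integrable[OF Y]]
      l2_inner_cls[OF test_fun_sq_integrable[OF \<phi>] rep_sq_integrable[OF Z]]
    by (simp_all add: D_op_cls[OF \<phi>] cls_rep Y Z)
  then show ?thesis
    by (simp add: D_dom_def weak_adjoint_def rep_sq_integrable[OF Y] rep_sq_integrable[OF Z])
qed

lemma weak_adjoint_rep_cls:
  assumes "weak_adjoint {a<..<b} q f"
  shows "weak_adjoint {a<..<b} (rep (cls (lebesgue_on {a<..<b}) q)) (rep (cls (lebesgue_on {a<..<b}) f))"
proof -
  have sq: "q \<in> sq_integrable (lebesgue_on {a<..<b})" "f \<in> sq_integrable (lebesgue_on {a<..<b})"
    using assms by (auto simp: weak_adjoint_def)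
  show ?thesis
    by (rule weak_adjoint_cong_AE[OF assms])
      (use rep_cls[OF sq(1)] rep_cls[OF sq(2)] in \<open>auto elim: eventually_mono\<close>)
qed

lemma D_adj_eq_if_weak_adjoint:
  assumes Y: "Y \<in> L2 (lebesgue_on {a<..<b})" and Z: "Z \<in> L2 (lebesgue_on {a<..<b})"
    and weak: "weak_adjoint {a<..<b} (rep Y) (rep Z)"
  shows "Y \<in> W1 {a<..<b}" and "D_adj {a<..<b} Y = Z"
proof -
  let ?M = "lebesgue_on {a<..<b}"
  show "Y \<in> W1 {a<..<b}"
    using assms adjoint_relation_iff[OF Y Z] unfolding W1_def adj_dom_def by blast
  show "D_adj {a<..<b} Y = Z"
    unfolding D_adj_def adj_def
  proof (rule the_equality)
    show "Z \<in> L2 ?M \<and> (\<forall>X\<in>D_dom {a<..<b}. l2_inner ?M (D_op {a<..<b} X) Y = l2_inner ?M X Z)"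
      using weak Z adjoint_relation_iff[OF Y Z] by simp
    fix Z'
    assume "Z' \<in> L2 ?M \<and> (\<forall>X\<in>D_dom {a<..<b}. l2_inner ?M (D_op {a<..<b} X) Y = l2_inner ?M X Z')"
    then have Z': "Z' \<in> L2 ?M" and weak': "weak_adjoint {a<..<b} (rep Y) (rep Z')"
      using adjoint_relation_iff[OF Y] by auto
    have "AE x in ?M. rep Z' x = rep Z x"
      by (rule weak_adjoint_unique[OF weak' weak]) simp
    then have "cls ?M (rep Z') = cls ?M (rep Z)"
      by (intro cls_eqI rep_sq_integrable Z Z')
    then show "Z' = Z"
      by (simp add: cls_rep Z Z')
  qed
qed

lemma D_adj_cls:
  assumes "weak_adjoint {a<..<b} q f"
  shows "cls (lebesgue_on {a<..<b}) q \<in> W1 {a<..<b}"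
    and "D_adj {a<..<b} (cls (lebesgue_on {a<..<b}) q) = cls (lebesgue_on {a<..<b}) f"
  using D_adj_eq_if_weak_adjoint[OF _ _ weak_adjoint_rep_cls[OF assms]] assms
  by (simp_all add: cls_in_L2 weak_adjoint_def)

lemma W1D:
  assumes "Y \<in> W1 {a<..<b}"
  shows "Y \<in> L2 (lebesgue_on {a<..<b})" and "D_adj {a<..<b} Y \<in> L2 (lebesgue_on {a<..<b})"
    and "weak_adjoint {a<..<b} (rep Y) (rep (D_adj {a<..<b} Y))"
proof -
  obtain Z where "Y \<in> L2 (lebesgue_on {a<..<b})" "Z \<in> L2 (lebesgue_on {a<..<b})"
      "weak_adjoint {a<..<b} (rep Y) (rep Z)"
    using assms adjoint_relation_iff unfolding W1_def adj_dom_def by blast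
  moreover from D_adj_eq_if_weak_adjoint(2)[OF this] have "D_adj {a<..<b} Y = Z" .
  ultimately show "Y \<in> L2 (lebesgue_on {a<..<b})" "D_adj {a<..<b} Y \<in> L2 (lebesgue_on {a<..<b})"
    "weak_adjoint {a<..<b} (rep Y) (rep (D_adj {a<..<b} Y))"
    by simp_all
qed

lemma W1_norm_cls:
  assumes "weak_adjoint {a<..<b} q f"
  shows "W1_norm {a<..<b} (cls (lebesgue_on {a<..<b}) q) =
    sqrt ((fnorm (lebesgue_on {a<..<b}) q)\<^sup>2 + (fnorm (lebesgue_on {a<..<b}) f)\<^sup>2)"
  using assms unfolding W1_norm_def D_adj_cls(2)[OF assms]
  by (simp add: weak_adjoint_def l2_norm_cls_fnorm)

lemma W10_approximation:
  assumes X: "X \<in> W10 {a<..<b}" and "e > 0"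
  obtains \<phi> where "\<phi> \<in> test_funs {a<..<b}"
    "fnorm (lebesgue_on {a<..<b}) (\<lambda>x. rep X x - \<phi> x) < e"
    "fnorm (lebesgue_on {a<..<b}) (\<lambda>x. rep (D_adj {a<..<b} X) x + vector_derivative \<phi> (at x)) < e"
proof -
  let ?M = "lebesgue_on {a<..<b}"
  have X1: "X \<in> W1 {a<..<b}"
    using X by (simp add: W10_def)
  obtain \<phi> where \<phi>: "\<phi> \<in> test_funs {a<..<b}" "W1_norm {a<..<b} (l2_diff ?M X (cls ?M \<phi>)) < e"
    using X \<open>e > 0\<close> unfolding W10_def D_dom_def by blast
  note weak = weak_adjoint_diff[OF W1D(3)[OF X1] weak_adjoint_test_fun[OF \<phi>(1)] refl]
  have "l2_diff ?M X (cls ?M \<phi>) = cls ?M (\<lambda>x. rep X x - \<phi> x)"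
    using l2_diff_cls[OF rep_sq_integrable[OF W1D(1)[OF X1]] test_fun_sq_integrable[OF \<phi>(1)]]
    by (simp add: cls_rep W1D(1)[OF X1])
  then have "sqrt ((fnorm ?M (\<lambda>x. rep X x - \<phi> x))\<^sup>2 +
      (fnorm ?M (\<lambda>x. rep (D_adj {a<..<b} X) x + vector_derivative \<phi> (at x)))\<^sup>2) < e"
    using \<phi>(2) W1_norm_cls[OF weak] by simp
  then have "fnorm ?M (\<lambda>x. rep X x - \<phi> x) < e"
    "fnorm ?M (\<lambda>x. rep (D_adj {a<..<b} X) x + vector_derivative \<phi> (at x)) < e"
    by (auto intro: le_less_trans[OF real_sqrt_sum_squares_ge1] le_less_trans[OF real_sqrt_sum_squares_ge2])
  then show ?thesis
    using that \<phi>(1) by blast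
qed

text \<open>For \<open>X\<close> a test function this is the definition of the adjoint; both sides are continuous in \<open>X\<close> for the Sobolev norm.\<close>

lemma D_adj_antisymmetric:
  assumes X: "X \<in> W10 {a<..<b}" and Y: "Y \<in> W1 {a<..<b}"
  shows "l2_inner (lebesgue_on {a<..<b}) (D_adj {a<..<b} X) Y =
    - l2_inner (lebesgue_on {a<..<b}) X (D_adj {a<..<b} Y)"
proof -
  let ?M = "lebesgue_on {a<..<b}"
  define x x' y y' where "x = rep X" and "x' = rep (D_adj {a<..<b} X)"
    and "y = rep Y" and "y' = rep (D_adj {a<..<b} Y)"
  have X1: "X \<in> W1 {a<..<b}"
    using X by (simp add: W10_def)
  have sq: "x \<in> sq_integrable ?M" "x' \<in> sq_integrable ?M" "y \<in> sq_integrable ?M" "y' \<in> sq_integrable ?M"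
    unfolding x_def x'_def y_def y'_def by (intro rep_sq_integrable W1D X1 Y)+
  define S where "S = (LINT t|?M. cnj (x' t) * y t) + (LINT t|?M. cnj (x t) * y' t)"
  define K where "K = fnorm ?M y + fnorm ?M y'"
  have "K \<ge> 0" by (simp add: K_def)
  have bound: "cmod S \<le> e * K" if "e > 0" for e
  proof -
    obtain \<phi> where \<phi>: "\<phi> \<in> test_funs {a<..<b}" "fnorm ?M (\<lambda>t. x t - \<phi> t) < e"
        "fnorm ?M (\<lambda>t. x' t + vector_derivative \<phi> (at t)) < e"
      using W10_approximation[OF X \<open>e > 0\<close>] unfolding x_def x'_def by metis
    note d = test_fun_sq_integrable[OF \<phi>(1), of a b] test_fun_sq_integrable[OF test_funs_derivative[OF \<phi>(1)], of a b]
    have "(LINT t|?M. cnj (vector_derivative \<phi> (at t)) * y t) = (LINT t|?M. cnj (\<phi> t) * y' t)"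
      using W1D(3)[OF Y] \<phi>(1) unfolding weak_adjoint_def y_def y'_def by simp
    then have "S = (LINT t|?M. cnj (x' t + vector_derivative \<phi> (at t)) * y t) + (LINT t|?M. cnj (x t - \<phi> t) * y' t)"
      unfolding S_def
      using integrable_cnj_mult[OF d(1) sq(4)] integrable_cnj_mult[OF d(2) sq(3)]
        integrable_cnj_mult[OF sq(1) sq(4)] integrable_cnj_mult[OF sq(2) sq(3)]
      by (simp add: ring_distribs)
    then have "cmod S \<le> cmod (LINT t|?M. cnj (x' t + vector_derivative \<phi> (at t)) * y t) +
        cmod (LINT t|?M. cnj (x t - \<phi> t) * y' t)"
      using norm_triangle_ineq by simp
    also have "\<dots> \<le> fnorm ?M (\<lambda>t. x' t + vector_derivative \<phi> (at t)) * fnorm ?M y +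
        fnorm ?M (\<lambda>t. x t - \<phi> t) * fnorm ?M y'"
      by (intro add_mono cmod_integral_cnj_mult_le sq_integrable_add sq_integrable_diff sq d)
    also have "\<dots> \<le> e * fnorm ?M y + e * fnorm ?M y'"
      using \<phi> by (intro add_mono mult_right_mono) auto
    finally show ?thesis
      by (simp add: K_def distrib_left)
  qed
  have "S = 0"
  proof (rule ccontr)
    assume "S \<noteq> 0"
    \<comment> \<open>The choice \<open>e = cmod S / (K + 1)\<close> contradicts the bound, as \<open>K < K + 1\<close>.\<close>
    then have "cmod S \<le> cmod S / (K + 1) * K"
      using \<open>K \<ge> 0\<close> by (intro bound divide_pos_pos) auto
    then show False
      using \<open>S \<noteq> 0\<close> \<open>K \<ge> 0\<close> by (simp add: field_simps)
  qed
  then show ?thesis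
    unfolding S_def l2_inner_def x_def x'_def y_def y'_def by (simp add: add_eq_0_iff)
qed

text \<open>An approximating test function \<open>\<psi>\<close> has a small mean \<open>m\<close>, which is removed by subtracting \<open>(m / k) \<beta>\<close> for a fixed test function \<open>\<beta>\<close> of mean \<open>k \<noteq> 0\<close>.\<close>

lemma zero_mean_approximation:
  assumes "a < b" and w: "w \<in> sq_integrable (lebesgue_on {a<..<b})"
    and zero: "(LINT x|lebesgue_on {a<..<b}. w x) = 0" and "e > 0"
  shows "\<exists>\<psi>\<in>test_funs {a<..<b}. (LINT x|lebesgue_on {a<..<b}. \<psi> x) = 0 \<and>
    (fnorm (lebesgue_on {a<..<b}) (\<lambda>x. w x - \<psi> x))\<^sup>2 < e"
proof -
  let ?M = "lebesgue_on {a<..<b}"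
  interpret finite_measure ?M by (rule finite_measure_interval)
  note L1 = sq_integrable_imp_integrable[OF finite_measure_interval]
  have meas: "measure ?M (space ?M) = b - a"
    using \<open>a < b\<close> by (simp add: measure_interval)
  have mean_le: "cmod (LINT x|?M. f x) \<le> sqrt (b - a) * fnorm ?M f" if "f \<in> sq_integrable ?M" for f
    using integral_norm_bound[of ?M f] L1(2)[OF that] unfolding meas by linarith
  have one: "(\<lambda>x. 1) \<in> sq_integrable ?M"
    by (rule continuous_sq_integrable_interval) simp
  \<comment> \<open>A test function this close to the constant 1 cannot have mean zero.\<close>
  obtain \<beta> where \<beta>: "\<beta> \<in> test_funs {a<..<b}" "(fnorm ?M (\<lambda>x. 1 - \<beta> x))\<^sup>2 < b - a"
    using test_funs_dense_L2[OF one] \<open>a < b\<close> unfolding test_approximable_def by (meson diff_gt_0_iff_gt)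
  have \<beta>sq: "\<beta> \<in> sq_integrable ?M"
    by (rule test_fun_sq_integrable[OF \<beta>(1)])
  define k where "k = (LINT x|?M. \<beta> x)"
  have "k \<noteq> 0"
  proof
    assume "k = 0"
    then have "(LINT x|?M. 1 - \<beta> x) = complex_of_real (b - a)"
      using L1(1)[OF \<beta>sq] \<open>a < b\<close> by (simp add: k_def measure_interval scaleR_conv_of_real)
    then have "b - a \<le> sqrt (b - a) * fnorm ?M (\<lambda>x. 1 - \<beta> x)"
      using mean_le[OF sq_integrable_diff[OF one \<beta>sq]] \<open>a < b\<close> by (simp flip: of_real_diff)
    also have "\<dots> < sqrt (b - a) * sqrt (b - a)"
      using \<beta>(2) \<open>a < b\<close> by (intro mult_strict_left_mono real_less_rsqrt) auto
    finally show False
      using \<open>a < b\<close> by simp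
  qed
  \<comment> \<open>The factor by which removing the mean can enlarge the squared error.\<close>
  define C where "C = 2 + 2 * (b - a) * (fnorm ?M \<beta> / cmod k)\<^sup>2"
  have "C > 0"
    unfolding C_def using \<open>a < b\<close> by (intro add_pos_nonneg) auto
  then obtain \<psi> where \<psi>: "\<psi> \<in> test_funs {a<..<b}" "(fnorm ?M (\<lambda>x. w x - \<psi> x))\<^sup>2 < e / C"
    using test_funs_dense_L2[OF w] \<open>e > 0\<close> unfolding test_approximable_def by (meson divide_pos_pos)
  have \<psi>sq: "\<psi> \<in> sq_integrable ?M"
    by (rule test_fun_sq_integrable[OF \<psi>(1)])
  define m where "m = (LINT x|?M. \<psi> x)"
  have "cmod m = cmod (LINT x|?M. w x - \<psi> x)"
    using L1(1)[OF w] L1(1)[OF \<psi>sq] zero by (simp add: m_def)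
  also have "\<dots> \<le> sqrt (b - a) * fnorm ?M (\<lambda>x. w x - \<psi> x)"
    by (intro mean_le sq_integrable_diff w \<psi>sq)
  finally have "(cmod m)\<^sup>2 \<le> (sqrt (b - a) * fnorm ?M (\<lambda>x. w x - \<psi> x))\<^sup>2"
    by (rule power_mono) simp
  then have m: "(cmod m)\<^sup>2 \<le> (b - a) * (fnorm ?M (\<lambda>x. w x - \<psi> x))\<^sup>2"
    using \<open>a < b\<close> by (simp add: power_mult_distrib)
  define \<eta> where "\<eta> x = \<psi> x + (- m / k) * \<beta> x" for x
  have "\<eta> \<in> test_funs {a<..<b}"
    unfolding \<eta>_def by (intro test_funs_add test_funs_cmult \<psi> \<beta>)
  moreover have "(LINT x|?M. \<eta> x) = 0"
    unfolding \<eta>_def using L1(1)[OF \<psi>sq] L1(1)[OF \<beta>sq] \<open>k \<noteq> 0\<close> by (simp add: m_def k_def)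
  moreover have "(fnorm ?M (\<lambda>x. w x - \<eta> x))\<^sup>2 < e"
  proof -
    have "(fnorm ?M (\<lambda>x. w x - \<eta> x))\<^sup>2 = (fnorm ?M (\<lambda>x. (w x - \<psi> x) + (m / k) * \<beta> x))\<^sup>2"
      by (simp add: \<eta>_def algebra_simps)
    also have "\<dots> \<le> 2 * (fnorm ?M (\<lambda>x. w x - \<psi> x))\<^sup>2 + 2 * (fnorm ?M (\<lambda>x. (m / k) * \<beta> x))\<^sup>2"
      by (intro fnorm_add_sq_le sq_integrable_diff sq_integrable_cmult w \<psi>sq \<beta>sq)
    also have "(fnorm ?M (\<lambda>x. (m / k) * \<beta> x))\<^sup>2 = (cmod m)\<^sup>2 * (fnorm ?M \<beta> / cmod k)\<^sup>2"
      unfolding fnorm_cmult by (simp add: norm_divide power_mult_distrib power_divide)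
    also have "\<dots> \<le> ((b - a) * (fnorm ?M (\<lambda>x. w x - \<psi> x))\<^sup>2) * (fnorm ?M \<beta> / cmod k)\<^sup>2"
      using m by (rule mult_right_mono) simp
    finally have "(fnorm ?M (\<lambda>x. w x - \<eta> x))\<^sup>2 \<le> C * (fnorm ?M (\<lambda>x. w x - \<psi> x))\<^sup>2"
      by (simp add: C_def algebra_simps)
    also have "\<dots> < e"
      using \<psi>(2) \<open>C > 0\<close> by (simp add: field_simps)
    finally show ?thesis .
  qed
  ultimately show ?thesis by blast
qed

lemma fnorm_bounded_le:
  assumes "a < b" "h \<in> borel_measurable (lebesgue_on {a<..<b})"
    "\<And>x. x \<in> {a<..<b} \<Longrightarrow> cmod (h x) \<le> C" "C \<ge> 0"
  shows "fnorm (lebesgue_on {a<..<b}) h \<le> sqrt (b - a) * C"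
proof -
  let ?M = "lebesgue_on {a<..<b}"
  interpret finite_measure ?M by (rule finite_measure_interval)
  have h: "h \<in> sq_integrable ?M"
    using assms by (intro sq_integrable_bounded[OF finite_measure_interval, where C = C]) (auto intro!: AE_I2)
  have "(LINT x|?M. (cmod (h x))\<^sup>2) \<le> (LINT x|?M. C\<^sup>2)"
    using sq_integrable_integrableD[OF h] assms by (intro integral_mono power_mono) auto
  also have "\<dots> = (b - a) * C\<^sup>2"
    using \<open>a < b\<close> by (simp add: measure_interval)
  finally have "fnorm ?M h \<le> sqrt ((b - a) * C\<^sup>2)"
    by (simp add: fnorm_def)
  then show ?thesis
    using \<open>C \<ge> 0\<close> by (simp add: real_sqrt_mult)
qed

lemma weak_adjoint_primitive_minus:
  assumes w: "w \<in> sq_integrable (lebesgue_on {a<..<b})"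
  shows "weak_adjoint {a<..<b} (primitive (lebesgue_on {a<..<b}) w) (\<lambda>x. - w x)"
proof -
  let ?M = "lebesgue_on {a<..<b}"
  have "primitive ?M (\<lambda>t. - w t) x = - primitive ?M w x" for x
    using primitive_diff[OF integrable_zero sq_integrable_imp_integrable(1)[OF finite_measure_interval w], of x]
    by (simp add: primitive_def)
  then show ?thesis
    using weak_adjoint_primitive[OF sq_integrable_minus[OF w], of 0] by simp
qed

text \<open>Approximate \<open>w\<close> by mean zero test functions; their primitives are test functions and converge together with their derivatives.\<close>

lemma primitive_zero_mean_in_W10:
  assumes "a < b" and w: "w \<in> sq_integrable (lebesgue_on {a<..<b})"
    and zero: "(LINT x|lebesgue_on {a<..<b}. w x) = 0"
  shows "cls (lebesgue_on {a<..<b}) (primitive (lebesgue_on {a<..<b}) w) \<in> W10 {a<..<b}"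
  unfolding W10_def
proof (intro CollectI conjI allI impI)
  let ?M = "lebesgue_on {a<..<b}"
  note L1 = sq_integrable_imp_integrable[OF finite_measure_interval]
  note weak = weak_adjoint_primitive_minus[OF w]
  show "cls ?M (primitive ?M w) \<in> W1 {a<..<b}"
    by (rule D_adj_cls[OF weak])
  fix e :: real assume "e > 0"
  define C where "C = (b - a)\<^sup>2 + 1"
  have "C > 0" by (simp add: C_def add_nonneg_pos)
  then obtain \<psi> where \<psi>: "\<psi> \<in> test_funs {a<..<b}" "(LINT x|?M. \<psi> x) = 0"
      "(fnorm ?M (\<lambda>x. w x - \<psi> x))\<^sup>2 < e\<^sup>2 / C"
    using zero_mean_approximation[OF assms, of "e\<^sup>2 / C"] \<open>e > 0\<close> by auto
  obtain \<phi> where \<phi>: "\<phi> \<in> test_funs {a<..<b}" "\<And>x. vector_derivative \<phi> (at x) = \<psi> x"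
      "\<And>x. x \<in> {a<..<b} \<Longrightarrow> \<phi> x = primitive ?M \<psi> x"
    using test_fun_antiderivative[OF \<open>a < b\<close> \<psi>(1,2)] by blast
  have \<psi>sq: "\<psi> \<in> sq_integrable ?M" and \<phi>sq: "\<phi> \<in> sq_integrable ?M"
    by (rule test_fun_sq_integrable, rule \<psi> \<phi>)+
  have usq: "primitive ?M w \<in> sq_integrable ?M"
    by (rule primitive_sq_integrable[OF L1(1)[OF w]])
  let ?d = "fnorm ?M (\<lambda>x. w x - \<psi> x)"
  have "weak_adjoint {a<..<b} (\<lambda>x. primitive ?M w x - \<phi> x) (\<lambda>x. - w x - - \<psi> x)"
    using weak_adjoint_diff[OF weak weak_adjoint_test_fun[OF \<phi>(1)] refl] by (simp add: \<phi>(2))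
  then have W1: "W1_norm {a<..<b} (cls ?M (\<lambda>x. primitive ?M w x - \<phi> x)) =
      sqrt ((fnorm ?M (\<lambda>x. primitive ?M w x - \<phi> x))\<^sup>2 + (fnorm ?M (\<lambda>x. - w x - - \<psi> x))\<^sup>2)"
    by (rule W1_norm_cls)
  have "fnorm ?M (\<lambda>x. - w x - - \<psi> x) = ?d"
    using fnorm_minus[of ?M "\<lambda>x. w x - \<psi> x"] by simp
  moreover have "fnorm ?M (\<lambda>x. primitive ?M w x - \<phi> x) \<le> sqrt (b - a) * (sqrt (b - a) * ?d)"
  proof (rule fnorm_bounded_le[OF \<open>a < b\<close>])
    show "(\<lambda>x. primitive ?M w x - \<phi> x) \<in> borel_measurable ?M"
      by (intro sq_integrableD sq_integrable_diff usq \<phi>sq)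
    fix x assume x: "x \<in> {a<..<b}"
    have "cmod (primitive ?M w x - \<phi> x) = cmod (primitive ?M (\<lambda>t. w t - \<psi> t) x)"
      by (simp add: primitive_diff[OF L1(1)[OF w] L1(1)[OF \<psi>sq]] \<phi>(3)[OF x])
    also have "\<dots> \<le> (LINT t|?M. cmod (w t - \<psi> t))"
      by (intro cmod_primitive_le L1(1) sq_integrable_diff w \<psi>sq)
    also have "\<dots> \<le> sqrt (b - a) * ?d"
      using L1(2)[OF sq_integrable_diff[OF w \<psi>sq]] \<open>a < b\<close> by (simp add: measure_interval)
    finally show "cmod (primitive ?M w x - \<phi> x) \<le> sqrt (b - a) * ?d" .
  qed (use \<open>a < b\<close> in simp)
  then have "(fnorm ?M (\<lambda>x. primitive ?M w x - \<phi> x))\<^sup>2 \<le> ((b - a) * ?d)\<^sup>2"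
    using \<open>a < b\<close> by (intro power_mono) (simp_all flip: mult.assoc)
  ultimately have "(fnorm ?M (\<lambda>x. primitive ?M w x - \<phi> x))\<^sup>2 + (fnorm ?M (\<lambda>x. - w x - - \<psi> x))\<^sup>2 \<le> C * ?d\<^sup>2"
    by (simp add: C_def power_mult_distrib distrib_right)
  also have "\<dots> < e\<^sup>2"
    using \<psi>(3) \<open>C > 0\<close> by (simp add: field_simps)
  finally have "W1_norm {a<..<b} (cls ?M (\<lambda>x. primitive ?M w x - \<phi> x)) < e"
    unfolding W1 using \<open>e > 0\<close> by (intro real_less_lsqrt) auto
  moreover have "l2_diff ?M (cls ?M (primitive ?M w)) (cls ?M \<phi>) = cls ?M (\<lambda>x. primitive ?M w x - \<phi> x)"
    by (rule l2_diff_cls[OF usq \<phi>sq])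
  ultimately show "\<exists>Y\<in>D_dom {a<..<b}. W1_norm {a<..<b} (l2_diff ?M (cls ?M (primitive ?M w)) Y) < e"
    using \<phi>(1) unfolding D_dom_def by (intro bexI[of _ "cls ?M \<phi>"]) simp_all
qed

section \<open>The inverse operator and its dependence on the coefficient\<close>

locale nonneg_coefficient =
  fixes a b :: real and p :: "real \<Rightarrow> real"
  assumes interval: "a < b"
    and Linf: "p \<in> Linf (lebesgue_on {a<..<b})"
    and nonneg: "AE x in lebesgue_on {a<..<b}. p x \<ge> 0"
    and nonzero: "\<not> (AE x in lebesgue_on {a<..<b}. p x = 0)"
begin

abbreviation "M \<equiv> lebesgue_on {a<..<b}"

abbreviation "P \<equiv> l1_norm M p"

lemma measurable_p [measurable]: "p \<in> borel_measurable M"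
  using Linf by (simp add: Linf_def)

lemma p_mult_sq_integrable:
  assumes "f \<in> sq_integrable M"
  shows "(\<lambda>x. complex_of_real (p x) * f x) \<in> sq_integrable M"
proof -
  obtain C where "AE x in M. \<bar>p x\<bar> \<le> C"
    using Linf by (auto simp: Linf_def)
  then show ?thesis
    by (intro sq_integrable_bounded_mult[OF assms, where C = C]) auto
qed

lemma p_mult_integrable:
  "f \<in> sq_integrable M \<Longrightarrow> integrable M (\<lambda>x. complex_of_real (p x) * f x)"
  by (intro sq_integrable_imp_integrable(1)[OF finite_measure_interval] p_mult_sq_integrable)

lemma const_sq_integrable: "(\<lambda>x. c) \<in> sq_integrable M"
  by (rule continuous_sq_integrable_interval) simp

lemma integrable_p: "integrable M p"
  using p_mult_integrable[OF const_sq_integrable[of 1]] by (simp add: complex_of_real_integrable_eq)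

lemma P_eq: "P = (LINT x|M. p x)"
  unfolding l1_norm_def using nonneg by (intro integral_cong_AE) (auto elim: eventually_mono)

lemma P_pos: "P > 0"
proof -
  have "P \<ge> 0"
    by (simp add: l1_norm_def)
  moreover have "P \<noteq> 0"
  proof
    assume "P = 0"
    then have "AE x in M. \<bar>p x\<bar> = 0"
      unfolding l1_norm_def using integrable_p by (subst (asm) integral_nonneg_eq_0_iff_AE) auto
    then show False
      using nonzero by simp
  qed
  ultimately show ?thesis by simp
qed

text \<open>The component \<open>q = c - F\<close> of the solution, with the constant \<open>c\<close> for which \<open>g + p q\<close> has mean zero.\<close>

definition flux :: "(real \<Rightarrow> complex) \<Rightarrow> (real \<Rightarrow> complex) \<Rightarrow> real \<Rightarrow> complex" where
  "flux f g x = ((LINT t|M. complex_of_real (p t) * primitive M f t) - (LINT t|M. g t)) / complex_of_real P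
     - primitive M f x"

text \<open>The derivative of the component \<open>u\<close> of the solution.\<close>

definition slope :: "(real \<Rightarrow> complex) \<Rightarrow> (real \<Rightarrow> complex) \<Rightarrow> real \<Rightarrow> complex" where
  "slope f g x = g x + complex_of_real (p x) * flux f g x"

context
  fixes f g :: "real \<Rightarrow> complex"
  assumes f: "f \<in> sq_integrable M" and g: "g \<in> sq_integrable M"
begin

lemma f_integrable: "integrable M f" and g_integrable: "integrable M g"
  by (rule sq_integrable_imp_integrable(1)[OF finite_measure_interval f]
      sq_integrable_imp_integrable(1)[OF finite_measure_interval g])+

lemma weak_adjoint_flux: "weak_adjoint {a<..<b} (flux f g) f"
  unfolding flux_def by (rule weak_adjoint_primitive[OF f])

lemma flux_sq_integrable: "flux f g \<in> sq_integrable M"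
  using weak_adjoint_flux by (simp add: weak_adjoint_def)

lemma slope_sq_integrable: "slope f g \<in> sq_integrable M"
  unfolding slope_def by (intro sq_integrable_add g p_mult_sq_integrable flux_sq_integrable)

lemma integral_p_flux: "(LINT x|M. complex_of_real (p x) * flux f g x) = - (LINT x|M. g x)"
proof -
  define c where "c = ((LINT t|M. complex_of_real (p t) * primitive M f t) - (LINT t|M. g t)) / complex_of_real P"
  have "(LINT x|M. complex_of_real (p x) * flux f g x) =
      (LINT x|M. complex_of_real (p x) * c) - (LINT x|M. complex_of_real (p x) * primitive M f x)"
    unfolding flux_def c_def[symmetric] right_diff_distrib
    by (intro Bochner_Integration.integral_diff p_mult_integrable const_sq_integrable
        primitive_sq_integrable f_integrable)
  also have "(LINT x|M. complex_of_real (p x) * c) = complex_of_real P * c"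
    by (simp add: P_eq)
  finally show ?thesis
    using P_pos by (simp add: c_def)
qed

lemma integral_slope: "(LINT x|M. slope f g x) = 0"
  unfolding slope_def using integral_p_flux
  by (simp add: g_integrable p_mult_integrable[OF flux_sq_integrable])

lemma solution_in_A_dom:
  "(cls M (primitive M (slope f g)), cls M (flux f g)) \<in> A_dom {a<..<b}"
  unfolding A_dom_def
  using primitive_zero_mean_in_W10[OF interval slope_sq_integrable integral_slope]
    D_adj_cls(1)[OF weak_adjoint_flux] by simp

lemma A_op_solution:
  "A_op {a<..<b} p (cls M (primitive M (slope f g)), cls M (flux f g)) = (cls M f, cls M g)"
proof -
  have "cls M (\<lambda>x. - rep (cls M (\<lambda>x. - slope f g x)) x - complex_of_real (p x) * rep (cls M (flux f g)) x) = cls M g"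
  proof (rule cls_eqI)
    note s = rep_cls[OF sq_integrable_minus[OF slope_sq_integrable]] and q = rep_cls[OF flux_sq_integrable]
    show "(\<lambda>x. - rep (cls M (\<lambda>x. - slope f g x)) x - complex_of_real (p x) * rep (cls M (flux f g)) x) \<in> sq_integrable M"
      by (intro sq_integrable_diff sq_integrable_minus p_mult_sq_integrable s q)
    show "AE x in M. - rep (cls M (\<lambda>x. - slope f g x)) x - complex_of_real (p x) * rep (cls M (flux f g)) x = g x"
      using s(2) q(2) by eventually_elim (simp add: slope_def)
  qed (rule g)
  then show ?thesis
    by (simp add: A_op_def D_adj_cls(2)[OF weak_adjoint_flux]
        D_adj_cls(2)[OF weak_adjoint_primitive_minus[OF slope_sq_integrable]])
qed

text \<open>Multiplied by \<open>P\<close>, the flux at \<open>x\<close> is \<open>\<integral> p (F - F(x)) - \<integral> g\<close>, and values of \<open>F\<close> differ by at most \<open>\<parallel>f\<parallel>\<^sub>1\<close>.\<close>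

lemma cmod_flux_le:
  "cmod (flux f g x) \<le> (LINT t|M. cmod (f t)) + (LINT t|M. cmod (g t)) / P"
proof -
  let ?F = "LINT t|M. cmod (f t)"
  have prim: "cmod (primitive M f t - primitive M f x) \<le> ?F" for t
  proof -
    note int = integrable_primitive_integrand[OF f_integrable]
    have "primitive M f t - primitive M f x =
        (LINT s|M. (if s \<le> t then f s else 0) - (if s \<le> x then f s else 0))"
      unfolding primitive_def by (rule Bochner_Integration.integral_diff[OF int int, symmetric])
    also have "cmod \<dots> \<le> (LINT s|M. cmod ((if s \<le> t then f s else 0) - (if s \<le> x then f s else 0)))"
      by (rule integral_norm_bound)
    also have "\<dots> \<le> ?F"
      using f_integrable
      by (intro integral_mono integrable_norm Bochner_Integration.integrable_diff int) auto
    finally show ?thesis .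
  qed
  have F: "primitive M f \<in> sq_integrable M"
    by (rule primitive_sq_integrable[OF f_integrable])
  have "complex_of_real P * flux f g x =
      (LINT t|M. complex_of_real (p t) * primitive M f t) - (LINT t|M. g t)
        - (LINT t|M. complex_of_real (p t) * primitive M f x)"
    using P_pos by (simp add: flux_def field_simps P_eq)
  also have "\<dots> = (LINT t|M. complex_of_real (p t) * (primitive M f t - primitive M f x)) - (LINT t|M. g t)"
    using Bochner_Integration.integral_diff[OF p_mult_integrable[OF F] p_mult_integrable[OF const_sq_integrable[of "primitive M f x"]]]
    by (simp add: right_diff_distrib)
  finally have "P * cmod (flux f g x) =
      cmod ((LINT t|M. complex_of_real (p t) * (primitive M f t - primitive M f x)) - (LINT t|M. g t))"
    using P_pos by (metis abs_of_pos norm_mult norm_of_real)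
  also have "\<dots> \<le> cmod (LINT t|M. complex_of_real (p t) * (primitive M f t - primitive M f x)) + cmod (LINT t|M. g t)"
    by (rule norm_triangle_ineq4)
  also have "cmod (LINT t|M. complex_of_real (p t) * (primitive M f t - primitive M f x)) \<le>
      (LINT t|M. cmod (complex_of_real (p t) * (primitive M f t - primitive M f x)))"
    by (rule integral_norm_bound)
  also have "\<dots> \<le> (LINT t|M. \<bar>p t\<bar> * ?F)"
    using prim by (intro integral_mono integrable_norm p_mult_integrable sq_integrable_diff F const_sq_integrable)
      (auto simp: norm_mult integrable_p intro!: mult_left_mono)
  also have "\<dots> = P * ?F"
    by (simp add: l1_norm_def)
  also have "cmod (LINT t|M. g t) \<le> (LINT t|M. cmod (g t))"
    by (rule integral_norm_bound)
  finally have "P * cmod (flux f g x) \<le> P * ?F + (LINT t|M. cmod (g t))"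
    by simp
  then show ?thesis
    using P_pos by (simp add: field_simps)
qed

end

text \<open>Multiplication by the real function \<open>p\<close> is symmetric, and the off-diagonal entries are formally adjoint to each other because one factor always lies in \<open>W10\<close>.\<close>

lemma A_op_symmetric:
  assumes z: "z \<in> A_dom {a<..<b}" and z': "z' \<in> A_dom {a<..<b}"
  shows "l2_inner M (fst (A_op {a<..<b} p z)) (fst z') + l2_inner M (snd (A_op {a<..<b} p z)) (snd z') =
    l2_inner M (fst z) (fst (A_op {a<..<b} p z')) + l2_inner M (snd z) (snd (A_op {a<..<b} p z'))"
proof -
  obtain u q v r where eq: "z = (u, q)" "z' = (v, r)"
    by fastforce
  have dom: "u \<in> W10 {a<..<b}" "v \<in> W10 {a<..<b}" "q \<in> W1 {a<..<b}" "r \<in> W1 {a<..<b}"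
    using z z' by (auto simp: A_dom_def eq)
  then have W1: "u \<in> W1 {a<..<b}" "v \<in> W1 {a<..<b}"
    by (auto simp: W10_def)
  let ?D = "\<lambda>X. D_adj {a<..<b} X"
  note L2 = W1D(1)[OF dom(3)] W1D(1)[OF dom(4)] W1D(2)[OF W1(1)] W1D(2)[OF W1(2)]
  note sq = L2[THEN rep_sq_integrable]
  define J where "J = (LINT x|M. complex_of_real (p x) * (cnj (rep q x) * rep r x))"
  have "l2_inner M (cls M (\<lambda>x. - rep (?D u) x - complex_of_real (p x) * rep q x)) (cls M (rep r)) =
      (LINT x|M. - (cnj (rep (?D u) x) * rep r x) - complex_of_real (p x) * (cnj (rep q x) * rep r x))"
    by (subst l2_inner_cls)
      (auto intro!: sq_integrable_diff sq_integrable_minus p_mult_sq_integrable sq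
        simp: left_diff_distrib mult.assoc)
  also have "\<dots> = - l2_inner M (?D u) r - J"
    using integrable_cnj_mult[OF sq(3) sq(2)]
      integrable_cnj_mult[OF p_mult_sq_integrable[OF sq(1)] sq(2)]
    unfolding J_def l2_inner_def by (simp add: mult.assoc)
  finally have 1: "l2_inner M (snd (A_op {a<..<b} p z)) (snd z') = - l2_inner M (?D u) r - J"
    by (simp add: A_op_def eq cls_rep L2)
  have "l2_inner M (cls M (rep q)) (cls M (\<lambda>x. - rep (?D v) x - complex_of_real (p x) * rep r x)) =
      (LINT x|M. - (cnj (rep q x) * rep (?D v) x) - complex_of_real (p x) * (cnj (rep q x) * rep r x))"
    by (subst l2_inner_cls)
      (auto intro!: sq_integrable_diff sq_integrable_minus p_mult_sq_integrable sq
        simp: right_diff_distrib mult.left_commute)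
  also have "\<dots> = - l2_inner M q (?D v) - J"
    using integrable_cnj_mult[OF sq(1) sq(4)]
      integrable_cnj_mult[OF sq(1) p_mult_sq_integrable[OF sq(2)]]
    unfolding J_def l2_inner_def by (simp add: mult.left_commute)
  finally have 2: "l2_inner M (snd z) (snd (A_op {a<..<b} p z')) = - l2_inner M q (?D v) - J"
    by (simp add: A_op_def eq cls_rep L2)
  have "l2_inner M (?D q) v = - l2_inner M q (?D v)"
    using D_adj_antisymmetric[OF dom(2,3)] l2_inner_commute[of M "?D q" v] l2_inner_commute[of M q "?D v"]
    by simp
  moreover have "l2_inner M (?D u) r = - l2_inner M u (?D r)"
    by (rule D_adj_antisymmetric[OF dom(1,4)])
  ultimately show ?thesis
    unfolding 1 2 by (simp add: eq A_op_def)
qed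

text \<open>If two elements have the same image, symmetry makes their difference orthogonal to the range, and the explicit solution shows that the difference itself is in the range.\<close>

lemma inj_on_A_op: "inj_on (A_op {a<..<b} p) (A_dom {a<..<b})"
proof (rule inj_onI)
  fix z z' assume z: "z \<in> A_dom {a<..<b}" and z': "z' \<in> A_dom {a<..<b}"
    and eq: "A_op {a<..<b} p z = A_op {a<..<b} p z'"
  obtain u q v r where zz: "z = (u, q)" "z' = (v, r)"
    by fastforce
  have L2: "u \<in> L2 M" "q \<in> L2 M" "v \<in> L2 M" "r \<in> L2 M"
    using z z' W1D(1) unfolding zz A_dom_def W10_def by blast+
  note sq = L2[THEN rep_sq_integrable]
  define f g where "f x = rep u x - rep v x" and "g x = rep q x - rep r x" for x
  have f: "f \<in> sq_integrable M" and g: "g \<in> sq_integrable M"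
    unfolding f_def g_def by (intro sq_integrable_diff sq)+
  define w where "w = (cls M (primitive M (slope f g)), cls M (flux f g))"
  have w: "w \<in> A_dom {a<..<b}" "A_op {a<..<b} p w = (cls M f, cls M g)"
    unfolding w_def by (rule solution_in_A_dom[OF f g] A_op_solution[OF f g])+
  have "l2_inner M u (cls M f) + l2_inner M q (cls M g) = l2_inner M v (cls M f) + l2_inner M r (cls M g)"
    using A_op_symmetric[OF z w(1)] A_op_symmetric[OF z' w(1)] unfolding eq w(2) by (simp add: zz)
  moreover have "l2_inner M X (cls M h) = (LINT x|M. cnj (rep X x) * h x)"
    if "X \<in> L2 M" "h \<in> sq_integrable M" for X h
    using l2_inner_cls[OF rep_sq_integrable[OF that(1)] that(2)] by (simp add: cls_rep that(1))
  ultimately have "(LINT x|M. cnj (rep u x) * f x) + (LINT x|M. cnj (rep q x) * g x) =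
      (LINT x|M. cnj (rep v x) * f x) + (LINT x|M. cnj (rep r x) * g x)"
    by (simp add: L2 f g)
  moreover have "(LINT x|M. cnj (f x) * f x) = (LINT x|M. cnj (rep u x) * f x) - (LINT x|M. cnj (rep v x) * f x)"
    using Bochner_Integration.integral_diff[OF integrable_cnj_mult[OF sq(1) f] integrable_cnj_mult[OF sq(3) f]]
    by (simp only: f_def complex_cnj_diff left_diff_distrib)
  moreover have "(LINT x|M. cnj (g x) * g x) = (LINT x|M. cnj (rep q x) * g x) - (LINT x|M. cnj (rep r x) * g x)"
    using Bochner_Integration.integral_diff[OF integrable_cnj_mult[OF sq(2) g] integrable_cnj_mult[OF sq(4) g]]
    by (simp only: g_def complex_cnj_diff left_diff_distrib)
  ultimately have "(LINT x|M. cnj (f x) * f x) + (LINT x|M. cnj (g x) * g x) = 0"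
    by (simp only: add_diff_add[symmetric] diff_self)
  moreover have "(LINT x|M. cnj (h x) * h x) = complex_of_real ((fnorm M h)\<^sup>2)" for h
    unfolding fnorm_sq by (simp only: complex_norm_square mult.commute flip: integral_complex_of_real)
  ultimately have "complex_of_real ((fnorm M f)\<^sup>2 + (fnorm M g)\<^sup>2) = 0"
    by simp
  then have "(fnorm M f)\<^sup>2 + (fnorm M g)\<^sup>2 = 0"
    by (simp only: of_real_eq_0_iff)
  then have "fnorm M f = 0" "fnorm M g = 0"
    by (simp_all add: sum_power2_eq_zero_iff)
  then have "AE x in M. f x = 0" "AE x in M. g x = 0"
    using AE_zero_if_fnorm_zero f g by blast+
  then have "cls M (rep u) = cls M (rep v)" "cls M (rep q) = cls M (rep r)"
    by (intro cls_eqI sq; simp add: f_def g_def)+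
  then show "z = z'"
    by (simp add: zz cls_rep L2)
qed

lemma A_inv_eq:
  assumes "f \<in> sq_integrable M" "g \<in> sq_integrable M"
  shows "A_inv {a<..<b} p (cls M f, cls M g) = (cls M (primitive M (slope f g)), cls M (flux f g))"
  unfolding A_inv_def
  by (rule the_inv_into_f_eq[OF inj_on_A_op A_op_solution[OF assms] solution_in_A_dom[OF assms]])

end

text \<open>Both fluxes are minus the same primitive up to a constant, so their difference is constant. From \<open>\<integral> p\<^sub>1 q\<^sub>1 = \<integral> p\<^sub>2 q\<^sub>2\<close> one may split off \<open>d\<close> in two ways, keeping either \<open>q\<^sub>2\<close> or \<open>q\<^sub>1\<close> under the integral; both bounds are used.\<close>

lemma flux_difference:
  assumes "nonneg_coefficient a b p1" "nonneg_coefficient a b p2"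
    and f: "f \<in> sq_integrable (lebesgue_on {a<..<b})" and g: "g \<in> sq_integrable (lebesgue_on {a<..<b})"
    and K1: "\<And>x. cmod (nonneg_coefficient.flux a b p1 f g x) \<le> K1"
    and K2: "\<And>x. cmod (nonneg_coefficient.flux a b p2 f g x) \<le> K2"
  shows "\<exists>d. (\<forall>x. nonneg_coefficient.flux a b p1 f g x - nonneg_coefficient.flux a b p2 f g x = d) \<and>
    l1_norm (lebesgue_on {a<..<b}) p1 * cmod d \<le> l1_norm (lebesgue_on {a<..<b}) (\<lambda>x. p2 x - p1 x) * K2 \<and>
    l1_norm (lebesgue_on {a<..<b}) p2 * cmod d \<le> l1_norm (lebesgue_on {a<..<b}) (\<lambda>x. p2 x - p1 x) * K1"
proof -
  interpret p1: nonneg_coefficient a b p1 by fact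
  interpret p2: nonneg_coefficient a b p2 by fact
  let ?M = "lebesgue_on {a<..<b}"
  define q1 q2 where "q1 = p1.flux f g" and "q2 = p2.flux f g"
  have sq: "q1 \<in> sq_integrable ?M" "q2 \<in> sq_integrable ?M"
    unfolding q1_def q2_def by (rule p1.flux_sq_integrable[OF f g] p2.flux_sq_integrable[OF f g])+
  define d where "d = q1 0 - q2 0"
  have d: "q1 x - q2 x = d" for x
    unfolding d_def q1_def q2_def p1.flux_def p2.flux_def by simp
  note int = p1.p_mult_integrable p2.p_mult_integrable
  have same: "(LINT x|?M. complex_of_real (p1 x) * q1 x) = (LINT x|?M. complex_of_real (p2 x) * q2 x)"
    unfolding q1_def q2_def p1.integral_p_flux[OF f g] p2.integral_p_flux[OF f g] ..
  have bound: "cmod (LINT x|?M. complex_of_real (p2 x - p1 x) * q x) \<le> l1_norm ?M (\<lambda>x. p2 x - p1 x) * K"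
    if q: "q \<in> sq_integrable ?M" and K: "\<And>x. cmod (q x) \<le> K" for q K
  proof -
    have "integrable ?M (\<lambda>x. complex_of_real (p2 x - p1 x) * q x)"
      using Bochner_Integration.integrable_diff[OF int(2,1)[OF q]] by (simp add: left_diff_distrib)
    then have "(LINT x|?M. cmod (complex_of_real (p2 x - p1 x) * q x)) \<le> (LINT x|?M. \<bar>p2 x - p1 x\<bar> * K)"
      using p1.integrable_p p2.integrable_p K
      by (intro integral_mono integrable_norm) (auto simp: norm_mult simp flip: of_real_diff intro!: mult_left_mono)
    then show ?thesis
      by (intro order_trans[OF integral_norm_bound]) (simp add: l1_norm_def)
  qed
  have 1: "complex_of_real p1.P * d = (LINT x|?M. complex_of_real (p2 x - p1 x) * q2 x)"
  proof -
    have "complex_of_real p1.P * d = (LINT x|?M. complex_of_real (p1 x) * (q1 x - q2 x))"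
      unfolding d by (simp add: p1.P_eq)
    also have "\<dots> = (LINT x|?M. complex_of_real (p2 x) * q2 x) - (LINT x|?M. complex_of_real (p1 x) * q2 x)"
      using int(1)[OF sq(1)] int(1)[OF sq(2)] by (simp add: right_diff_distrib same)
    also have "\<dots> = (LINT x|?M. complex_of_real (p2 x - p1 x) * q2 x)"
      using int(1)[OF sq(2)] int(2)[OF sq(2)] by (simp add: left_diff_distrib)
    finally show ?thesis .
  qed
  have 2: "complex_of_real p2.P * d = (LINT x|?M. complex_of_real (p2 x - p1 x) * q1 x)"
  proof -
    have "complex_of_real p2.P * d = (LINT x|?M. complex_of_real (p2 x) * (q1 x - q2 x))"
      unfolding d by (simp add: p2.P_eq)
    also have "\<dots> = (LINT x|?M. complex_of_real (p2 x) * q1 x) - (LINT x|?M. complex_of_real (p1 x) * q1 x)"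
      using int(2)[OF sq(1)] int(2)[OF sq(2)] by (simp add: right_diff_distrib same)
    also have "\<dots> = (LINT x|?M. complex_of_real (p2 x - p1 x) * q1 x)"
      using int(1)[OF sq(1)] int(2)[OF sq(1)] by (simp add: left_diff_distrib)
    finally show ?thesis .
  qed
  show ?thesis
  proof (intro exI[of _ d] conjI allI)
    show "p1.flux f g x - p2.flux f g x = d" for x
      using d unfolding q1_def q2_def .
    show "p1.P * cmod d \<le> l1_norm ?M (\<lambda>x. p2 x - p1 x) * K2"
      using bound[OF sq(2) K2[folded q2_def]] p1.P_pos
      unfolding 1[symmetric] norm_mult norm_of_real by simp
    show "p2.P * cmod d \<le> l1_norm ?M (\<lambda>x. p2 x - p1 x) * K1"
      using bound[OF sq(1) K1[folded q1_def]] p2.P_pos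
      unfolding 2[symmetric] norm_mult norm_of_real by simp
  qed
qed

lemma A_inv_difference_bound:
  assumes "nonneg_coefficient a b p1" "nonneg_coefficient a b p2"
    and v: "v \<in> L2 (lebesgue_on {a<..<b}) \<times> L2 (lebesgue_on {a<..<b})"
  shows "pair_norm (lebesgue_on {a<..<b})
      (pair_diff (lebesgue_on {a<..<b}) (A_inv {a<..<b} p1 v) (A_inv {a<..<b} p2 v)) \<le>
    2 * (b - a) / l1_norm (lebesgue_on {a<..<b}) p1 *
      (2 + l1_norm (lebesgue_on {a<..<b}) p1 + l1_norm (lebesgue_on {a<..<b}) p2
         + 1 / l1_norm (lebesgue_on {a<..<b}) p2) *
      l1_norm (lebesgue_on {a<..<b}) (\<lambda>x. p2 x - p1 x) * pair_norm (lebesgue_on {a<..<b}) v"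
proof -
  interpret p1: nonneg_coefficient a b p1 by fact
  interpret p2: nonneg_coefficient a b p2 by fact
  let ?M = "lebesgue_on {a<..<b}"
  note L1 = sq_integrable_imp_integrable[OF finite_measure_interval]
  define \<Delta> where "\<Delta> = l1_norm ?M (\<lambda>x. p2 x - p1 x)"
  define N where "N = pair_norm ?M v"
  define s where "s = sqrt (b - a)"
  have s: "s \<ge> 0" "s * s = b - a"
    using p1.interval by (simp_all add: s_def)
  have \<Delta>: "\<Delta> \<ge> 0"
    by (simp add: \<Delta>_def l1_norm_def)
  have N: "N \<ge> 0"
    by (simp add: N_def pair_norm_def)
  obtain X Y where XY: "v = (X, Y)" "X \<in> L2 ?M" "Y \<in> L2 ?M"
    using v by auto
  define f g where "f = rep X" and "g = rep Y"
  have f: "f \<in> sq_integrable ?M" and g: "g \<in> sq_integrable ?M"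
    unfolding f_def g_def by (intro rep_sq_integrable XY)+
  have v_eq: "v = (cls ?M f, cls ?M g)"
    by (simp add: XY f_def g_def cls_rep)
  have "N = sqrt ((fnorm ?M f)\<^sup>2 + (fnorm ?M g)\<^sup>2)"
    by (simp add: N_def v_eq pair_norm_def l2_norm_cls_fnorm f g)
  then have "fnorm ?M f \<le> N" "fnorm ?M g \<le> N"
    by simp_all
  then have L1_le: "(LINT t|?M. cmod (f t)) \<le> s * N" "(LINT t|?M. cmod (g t)) \<le> s * N"
    using L1(2)[OF f] L1(2)[OF g] p1.interval mult_left_mono[OF _ s(1)]
    by (auto simp: measure_interval s_def intro: order_trans)
  define K1 K2 where "K1 = s * N * (1 + 1 / p1.P)" and "K2 = s * N * (1 + 1 / p2.P)"
  have K1: "cmod (p1.flux f g x) \<le> K1" for x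
    using p1.cmod_flux_le[OF f g, of x] L1_le divide_right_mono[OF L1_le(2), of p1.P] p1.P_pos
    by (simp add: K1_def distrib_left)
  have K2: "cmod (p2.flux f g x) \<le> K2" for x
    using p2.cmod_flux_le[OF f g, of x] L1_le divide_right_mono[OF L1_le(2), of p2.P] p2.P_pos
    by (simp add: K2_def distrib_left)
  have K1_nonneg: "K1 \<ge> 0"
    using K1[of 0] norm_ge_zero order_trans by blast
  obtain d where d: "\<And>x. p1.flux f g x - p2.flux f g x = d"
      and d1: "p1.P * cmod d \<le> \<Delta> * K2" and d2: "p2.P * cmod d \<le> \<Delta> * K1"
    using flux_difference[OF assms(1,2) f g K1 K2] unfolding \<Delta>_def by blast
  note q_sq = p1.flux_sq_integrable[OF f g] p2.flux_sq_integrable[OF f g]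
  note w_sq = p1.slope_sq_integrable[OF f g] p2.slope_sq_integrable[OF f g]
  note u_sq = w_sq[THEN L1(1), THEN primitive_sq_integrable]
  have q_norm: "fnorm ?M (\<lambda>x. p1.flux f g x - p2.flux f g x) \<le> s * (\<Delta> * K2 / p1.P)"
    unfolding s_def
  proof (rule fnorm_bounded_le[OF p1.interval])
    show "cmod (p1.flux f g x - p2.flux f g x) \<le> \<Delta> * K2 / p1.P" for x
      unfolding d using d1 p1.P_pos by (simp add: field_simps)
    then show "0 \<le> \<Delta> * K2 / p1.P"
      using norm_ge_zero order_trans by blast
  qed (intro sq_integrableD sq_integrable_diff q_sq)
  have w_int: "(LINT x|?M. cmod (p1.slope f g x - p2.slope f g x)) \<le> 2 * \<Delta> * K1"
  proof -
    have "(LINT x|?M. cmod (p1.slope f g x - p2.slope f g x)) \<le>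
        (LINT x|?M. \<bar>p2 x - p1 x\<bar> * K1 + \<bar>p2 x\<bar> * cmod d)"
    proof (rule integral_mono)
      show "integrable ?M (\<lambda>x. cmod (p1.slope f g x - p2.slope f g x))"
        by (intro integrable_norm L1(1) sq_integrable_diff w_sq)
      show "integrable ?M (\<lambda>x. \<bar>p2 x - p1 x\<bar> * K1 + \<bar>p2 x\<bar> * cmod d)"
        using p1.integrable_p p2.integrable_p by auto
      fix x
      have "p1.slope f g x - p2.slope f g x =
          - (complex_of_real (p2 x - p1 x) * p1.flux f g x) + complex_of_real (p2 x) * d"
        unfolding p1.slope_def p2.slope_def d[of x, symmetric] by (simp add: algebra_simps)
      also have "cmod \<dots> \<le> \<bar>p2 x - p1 x\<bar> * cmod (p1.flux f g x) + \<bar>p2 x\<bar> * cmod d"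
        by (rule norm_triangle_le) (simp add: norm_mult flip: of_real_diff)
      also have "\<dots> \<le> \<bar>p2 x - p1 x\<bar> * K1 + \<bar>p2 x\<bar> * cmod d"
        using K1 by (intro add_mono mult_left_mono) auto
      finally show "cmod (p1.slope f g x - p2.slope f g x) \<le> \<bar>p2 x - p1 x\<bar> * K1 + \<bar>p2 x\<bar> * cmod d" .
    qed
    also have "\<dots> = \<Delta> * K1 + p2.P * cmod d"
      using p1.integrable_p p2.integrable_p by (simp add: \<Delta>_def l1_norm_def)
    finally show ?thesis
      using d2 by simp
  qed
  have u_norm: "fnorm ?M (\<lambda>x. primitive ?M (p1.slope f g) x - primitive ?M (p2.slope f g) x) \<le> s * (2 * \<Delta> * K1)"
    unfolding s_def
  proof (rule fnorm_bounded_le[OF p1.interval])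
    show "cmod (primitive ?M (p1.slope f g) x - primitive ?M (p2.slope f g) x) \<le> 2 * \<Delta> * K1" for x
      using cmod_primitive_le[OF L1(1)[OF sq_integrable_diff[OF w_sq]], of x] w_int
      by (simp add: primitive_diff[OF w_sq[THEN L1(1)]])
    show "0 \<le> 2 * \<Delta> * K1"
      using \<Delta> K1_nonneg by simp
  qed (intro sq_integrableD sq_integrable_diff u_sq)
  have "pair_norm ?M (pair_diff ?M (A_inv {a<..<b} p1 v) (A_inv {a<..<b} p2 v)) =
      sqrt ((fnorm ?M (\<lambda>x. primitive ?M (p1.slope f g) x - primitive ?M (p2.slope f g) x))\<^sup>2 +
        (fnorm ?M (\<lambda>x. p1.flux f g x - p2.flux f g x))\<^sup>2)"
    unfolding v_eq p1.A_inv_eq[OF f g] p2.A_inv_eq[OF f g] pair_diff_def pair_norm_def fst_conv snd_conv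
      l2_diff_cls[OF u_sq] l2_diff_cls[OF q_sq]
      l2_norm_cls_fnorm[OF sq_integrable_diff[OF u_sq]] l2_norm_cls_fnorm[OF sq_integrable_diff[OF q_sq]] ..
  also have "\<dots> \<le> fnorm ?M (\<lambda>x. primitive ?M (p1.slope f g) x - primitive ?M (p2.slope f g) x) +
      fnorm ?M (\<lambda>x. p1.flux f g x - p2.flux f g x)"
    by (rule sqrt_sum_squares_le_sum) simp_all
  also have "\<dots> \<le> s * (2 * \<Delta> * K1) + s * (\<Delta> * K2 / p1.P)"
    by (rule add_mono[OF u_norm q_norm])
  also have "\<dots> = (b - a) * \<Delta> * N / p1.P * (3 + 2 * p1.P + 1 / p2.P)"
    unfolding K1_def K2_def s(2)[symmetric] using p1.P_pos p2.P_pos by (simp add: field_simps)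
  also have "\<dots> \<le> (b - a) * \<Delta> * N / p1.P * (2 * (2 + p1.P + p2.P + 1 / p2.P))"
  proof (rule mult_left_mono)
    have "0 < 1 / p2.P"
      using p2.P_pos by simp
    then show "3 + 2 * p1.P + 1 / p2.P \<le> 2 * (2 + p1.P + p2.P + 1 / p2.P)"
      using p1.P_pos p2.P_pos unfolding distrib_left by linarith
  qed (use p1.P_pos p1.interval \<Delta> N in simp)
  also have "\<dots> = 2 * (b - a) / p1.P * (2 + p1.P + p2.P + 1 / p2.P) * \<Delta> * N"
    by (simp only: times_divide_eq_left times_divide_eq_right mult_ac)
  finally show ?thesis
    unfolding \<Delta>_def N_def .
qed

theorem theorem6p0p3:
  fixes a b :: real and I :: "real set" and p1 p2 :: "real \<Rightarrow> real"
  assumes "a < b" and "I = {a<..<b}"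
    and "p1 \<in> Linf (lebesgue_on I)" and "p2 \<in> Linf (lebesgue_on I)"
    and "\<not> (AE x in lebesgue_on I. p1 x = 0)" and "\<not> (AE x in lebesgue_on I. p2 x = 0)"
    and "AE x in lebesgue_on I. p1 x \<ge> 0" and "AE x in lebesgue_on I. p2 x \<ge> 0"
  shows "pair_opnorm (lebesgue_on I)
           (\<lambda>v. pair_diff (lebesgue_on I) (A_inv I p1 v) (A_inv I p2 v))
         \<le> ereal (2 * (b - a) / l1_norm (lebesgue_on I) p1
             * (2 + l1_norm (lebesgue_on I) p1 + l1_norm (lebesgue_on I) p2
                + 1 / l1_norm (lebesgue_on I) p2)
             * l1_norm (lebesgue_on I) (\<lambda>x. p2 x - p1 x))"
  (is "_ \<le> ereal ?C")
proof -
  have coeff: "nonneg_coefficient a b p1" "nonneg_coefficient a b p2"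
    using assms unfolding nonneg_coefficient_def by blast+
  have "?C \<ge> 0"
    using assms(1) by (intro mult_nonneg_nonneg divide_nonneg_nonneg add_nonneg_nonneg) (auto simp: l1_norm_def)
  have "pair_norm (lebesgue_on I) (pair_diff (lebesgue_on I) (A_inv I p1 v) (A_inv I p2 v))
      / pair_norm (lebesgue_on I) v \<le> ?C" if "v \<in> L2 (lebesgue_on I) \<times> L2 (lebesgue_on I)" for v
  proof (cases "pair_norm (lebesgue_on I) v = 0")
    case True
    then show ?thesis using \<open>?C \<ge> 0\<close> by simp
  next
    case False
    then have "pair_norm (lebesgue_on I) v > 0"
      by (simp add: pair_norm_def less_le)
    then show ?thesis
      using A_inv_difference_bound[OF coeff, folded assms(2), OF that] by (simp add: pos_divide_le_eq)
  qed
  then show ?thesis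
    unfolding pair_opnorm_def by (intro SUP_least) simp
qed

end
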